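(* Let $(M,F)$ be a regular AR-Finsler manifold of dimension $n$, with $g_{ij}(x,y)=\eta(x,y)\,a_{ij}(x,y)$. Then $(M,F)$ is Riemannian if and only if, for all $i=1,\dots,n$, $$\dot{\partial}_i \log(\eta) = -\frac{1}{n}\,a^{jk}\,\dot{\partial}_i a_{jk}.$$
   Context: $M$ is a smooth $n$-dimensional manifold with local coordinates $(x^i)$ and induced fibre coordinates $(y^i)$ on $TM$; $\partial_i=\partial/\partial x^i$, $\dot{\partial}_i=\partial/\partial y^i$; the summation convention is used. A (regular) Finsler metric on $M$ is a map $F:TM\to[0,\infty)$ which is $C^\infty$ on $TM\setminus\{0\}$, positively homogeneous of degree one in $y$, and such that $g_{ij}(x,y):=\frac12\dot{\partial}_i\dot{\partial}_jF^2$ is positive definite at each point of $TM\setminus\{0\}$; $(g^{ij})$ is the inverse matrix. "Rational in $y$" means: locally in $x$, a quotient of two polynomials in $y$ whose coefficients are smooth functions of $x$. $F$ is an AR-Finsler metric (and $(M,F)$ an AR-Finsler manifold) if $g_{ij}(x,y)=\eta(x,y)\,a_{ij}(x,y)$ where (a) $\eta:TM\setminus\{0\}\to[0,\infty)$ is smooth; (b) $(a_{ij}(x,y))$ is a symmetric positive definite matrix with each $a_{ij}$ rational in $y$; (c) each product $\eta\,a_{ij}$ is positively homogeneous of degree zero in $y$. Such a decomposition is fixed, and $(a^{ij})$ is the inverse matrix of $(a_{ij})$. The Cartan torsion is $C_{ijk}=\frac12\dot{\partial}_kg_{ij}$; $(M,F)$ is Riemannian if and only if $C_{ijk}=0$ identically.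 *)

theory Defs
  imports "HOL-Analysis.Analysis"
begin

subsection \<open>Smooth functions on open subsets of Euclidean spaces\<close>

text \<open>Meaningful on open sets only: the derivative is taken in the ambient space.\<close>

primrec Ck_on ::
  "nat \<Rightarrow> 'a::euclidean_space set \<Rightarrow> ('a \<Rightarrow> 'b::real_normed_vector) \<Rightarrow> bool" where
  "Ck_on 0 S f \<longleftrightarrow> continuous_on S f"
| "Ck_on (Suc k) S f \<longleftrightarrow>
     (\<forall>x\<in>S. f differentiable (at x)) \<and>
     (\<forall>b\<in>Basis. Ck_on k S (\<lambda>x. frechet_derivative f (at x) b))"

definition smooth_on :: "'a::euclidean_space set \<Rightarrow> ('a \<Rightarrow> 'b::real_normed_vector) \<Rightarrow> bool" where
  "smooth_on S f \<longleftrightarrow> (\<forall>k. Ck_on k S f)"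


subsection \<open>Smooth manifolds\<close>

text \<open>A chart \<open>(U, \<phi>)\<close>; values of \<open>\<phi>\<close> outside \<open>U\<close> are irrelevant.\<close>

type_synonym ('m, 'n) chart = "'m set \<times> ('m \<Rightarrow> real^'n)"

definition chart_dom :: "('m, 'n) chart \<Rightarrow> 'm set" where
  "chart_dom c = fst c"

definition chart_map :: "('m, 'n) chart \<Rightarrow> 'm \<Rightarrow> real^'n" where
  "chart_map c = snd c"

definition chart_image :: "('m, 'n) chart \<Rightarrow> (real^'n) set" where
  "chart_image c = chart_map c ` chart_dom c"

definition chart_inv :: "('m, 'n) chart \<Rightarrow> real^'n \<Rightarrow> 'm" where
  "chart_inv c = inv_into (chart_dom c) (chart_map c)"

definition transition :: "('m, 'n) chart \<Rightarrow> ('m, 'n) chart \<Rightarrow> real^'n \<Rightarrow> real^'n" where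
  "transition c d = chart_map d \<circ> chart_inv c"

definition is_chart :: "'m topology \<Rightarrow> ('m, 'n::finite) chart \<Rightarrow> bool" where
  "is_chart X c \<longleftrightarrow>
     openin X (chart_dom c) \<and> open (chart_image c) \<and>
     homeomorphic_map (subtopology X (chart_dom c)) (top_of_set (chart_image c)) (chart_map c)"

text \<open>The smooth structure is given by an arbitrary smooth atlas, which may be the maximal one;
  the dimension is \<open>CARD('n)\<close>.\<close>

definition smooth_manifold :: "'m topology \<Rightarrow> ('m, 'n::finite) chart set \<Rightarrow> bool" where
  "smooth_manifold X A \<longleftrightarrow>
     Hausdorff_space X \<and> second_countable X \<and>
     (\<forall>c\<in>A. is_chart X c) \<and> (\<Union>c\<in>A. chart_dom c) = topspace X \<and>
     (\<forall>c\<in>A. \<forall>d\<in>A. smooth_on (chart_map c ` (chart_dom c \<inter> chart_dom d)) (transition c d))"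


subsection \<open>The tangent bundle\<close>

text \<open>A tangent vector at \<open>p\<close> is the family of its component vectors in the charts around \<open>p\<close>,
  related by the Jacobians of the transition maps. Components in the other charts are set
  to \<open>0\<close>, so that a tangent vector is determined by its components in a single chart.\<close>

type_synonym ('m, 'n) tvector = "'m \<times> (('m, 'n) chart \<Rightarrow> real^'n)"

definition TM :: "'m topology \<Rightarrow> ('m, 'n::finite) chart set \<Rightarrow> ('m, 'n) tvector set" where
  "TM X A = {(p, v). p \<in> topspace X \<and>
     (\<forall>c. c \<notin> A \<or> p \<notin> chart_dom c \<longrightarrow> v c = 0) \<and>
     (\<forall>c\<in>A. \<forall>d\<in>A. p \<in> chart_dom c \<inter> chart_dom d \<longrightarrow>
        v d = frechet_derivative (transition c d) (at (chart_map c p)) (v c))}"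

definition slit_TM :: "'m topology \<Rightarrow> ('m, 'n::finite) chart set \<Rightarrow> ('m, 'n) tvector set" where
  "slit_TM X A = {w \<in> TM X A. snd w \<noteq> (\<lambda>c. 0)}"

definition scale_tv :: "real \<Rightarrow> ('m, 'n::finite) tvector \<Rightarrow> ('m, 'n) tvector" where
  "scale_tv t w = (fst w, \<lambda>c. t *\<^sub>R snd w c)"

text \<open>The tangent vector with induced coordinates \<open>(x, y)\<close> in the chart \<open>c\<close>.\<close>

definition tvec ::
  "('m, 'n::finite) chart set \<Rightarrow> ('m, 'n) chart \<Rightarrow> real^'n \<Rightarrow> real^'n \<Rightarrow> ('m, 'n) tvector" where
  "tvec A c x y = (chart_inv c x,
     \<lambda>d. if d \<in> A \<and> chart_inv c x \<in> chart_dom d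
         then frechet_derivative (transition c d) (at x) y else 0)"

text \<open>The vectors \<open>tvec A c x y\<close> are exactly the tangent vectors over the domain of \<open>c\<close>,
  and \<open>y\<close> is the component vector in \<open>c\<close>.\<close>

context
  fixes X :: "'m topology" and A :: "('m, 'n::finite) chart set"
  assumes mfd: "smooth_manifold X A"
begin

lemma chart_inv_map [simp]: "c \<in> A \<Longrightarrow> p \<in> chart_dom c \<Longrightarrow> chart_inv c (chart_map c p) = p"
proof -
  assume c: "c \<in> A" and p: "p \<in> chart_dom c"
  have "is_chart X c" using mfd c by (auto simp: smooth_manifold_def)
  then have "openin X (chart_dom c)"
    and "homeomorphic_map (subtopology X (chart_dom c)) (top_of_set (chart_image c)) (chart_map c)"
    by (auto simp: is_chart_def)
  then have "inj_on (chart_map c) (chart_dom c)"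
    by (simp add: homeomorphic_map_def openin_subset Int_absorb1)
  then show ?thesis using p by (simp add: chart_inv_def)
qed

lemma chart_map_inv:
  "x \<in> chart_image c \<Longrightarrow> chart_inv c x \<in> chart_dom c \<and> chart_map c (chart_inv c x) = x"
  by (simp add: chart_image_def chart_inv_def f_inv_into_f inv_into_into)

lemma open_chart_map_image:
  assumes c: "c \<in> A" and V: "openin X V" "V \<subseteq> chart_dom c"
  shows "open (chart_map c ` V)"
proof -
  have "is_chart X c" using mfd c by (auto simp: smooth_manifold_def)
  then have o: "open (chart_image c)" and
    h: "homeomorphic_map (subtopology X (chart_dom c)) (top_of_set (chart_image c)) (chart_map c)"
    by (auto simp: is_chart_def)
  have "openin (subtopology X (chart_dom c)) V"
    using V by (simp add: openin_subtopology) blast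
  then have "openin (top_of_set (chart_image c)) (chart_map c ` V)"
    using homeomorphic_imp_open_map[OF h] by (simp add: open_map_def)
  then show ?thesis using o by (rule openin_open_trans)
qed

lemma transition_has_derivative:
  assumes "c \<in> A" "d \<in> A" "p \<in> chart_dom c" "p \<in> chart_dom d"
  shows "(transition c d has_derivative
    frechet_derivative (transition c d) (at (chart_map c p))) (at (chart_map c p))"
proof -
  have "Ck_on (Suc 0) (chart_map c ` (chart_dom c \<inter> chart_dom d)) (transition c d)"
    using mfd assms unfolding smooth_manifold_def smooth_on_def by blast
  then have "transition c d differentiable (at (chart_map c p))" using assms by auto
  then show ?thesis by (simp add: frechet_derivative_works)
qed

lemma transition_cocycle:
  assumes A: "c \<in> A" "d \<in> A" "e \<in> A"
    and p: "p \<in> chart_dom c" "p \<in> chart_dom d" "p \<in> chart_dom e"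
  shows "frechet_derivative (transition c e) (at (chart_map c p)) y =
    frechet_derivative (transition d e) (at (chart_map d p))
      (frechet_derivative (transition c d) (at (chart_map c p)) y)"
proof -
  define V where "V = chart_dom c \<inter> chart_dom d \<inter> chart_dom e"
  have "openin X (chart_dom c')" if "c' \<in> A" for c'
    using mfd that by (auto simp: smooth_manifold_def is_chart_def)
  then have "openin X V" using A unfolding V_def by (intro openin_Int) blast+
  then have op: "open (chart_map c ` V)"
    using A by (intro open_chart_map_image) (auto simp: V_def)
  have tp: "transition c d (chart_map c p) = chart_map d p" using A p by (simp add: transition_def)
  have "((transition d e \<circ> transition c d) has_derivative
     (frechet_derivative (transition d e) (at (chart_map d p)) \<circ>
      frechet_derivative (transition c d) (at (chart_map c p)))) (at (chart_map c p))"
    using transition_has_derivative[of c d p] transition_has_derivative[of d e p] A p tp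
    by (auto intro!: diff_chain_at)
  then have "(transition c e has_derivative
     (frechet_derivative (transition d e) (at (chart_map d p)) \<circ>
      frechet_derivative (transition c d) (at (chart_map c p)))) (at (chart_map c p))"
    by (rule has_derivative_transform_within_open[OF _ op])
       (use A p in \<open>auto simp: V_def transition_def\<close>)
  then show ?thesis by (metis comp_apply frechet_derivative_at)
qed

lemma transition_self:
  assumes "c \<in> A" "p \<in> chart_dom c"
  shows "frechet_derivative (transition c c) (at (chart_map c p)) y = y"
proof -
  have "open (chart_image c)" using mfd assms by (auto simp: smooth_manifold_def is_chart_def)
  then have "(transition c c has_derivative (\<lambda>h. h)) (at (chart_map c p))"
    by (rule has_derivative_transform_within_open[OF has_derivative_ident])
       (use assms chart_map_inv in \<open>auto simp: chart_image_def transition_def\<close>)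
  then show ?thesis by (metis frechet_derivative_at)
qed

lemma snd_tvec: "c \<in> A \<Longrightarrow> x \<in> chart_image c \<Longrightarrow> snd (tvec A c x y) c = y"
  using chart_map_inv[of x c] transition_self[of c "chart_inv c x" y] by (simp add: tvec_def)

lemma tvec_in_TM:
  assumes "c \<in> A" "x \<in> chart_image c"
  shows "tvec A c x y \<in> TM X A"
proof -
  let ?p = "chart_inv c x"
  have p: "?p \<in> chart_dom c" "chart_map c ?p = x" using assms chart_map_inv[of x c] by auto
  have top: "?p \<in> topspace X" using mfd assms p by (auto simp: smooth_manifold_def)
  have coc: "frechet_derivative (transition c e) (at x) y =
      frechet_derivative (transition d e) (at (chart_map d ?p))
        (frechet_derivative (transition c d) (at x) y)"
    if "d \<in> A" "e \<in> A" "?p \<in> chart_dom d" "?p \<in> chart_dom e" for d e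
    using transition_cocycle[of c d e ?p y] that assms p by metis
  show ?thesis
    unfolding TM_def tvec_def mem_Collect_eq prod.case
  proof (intro conjI allI ballI impI)
    fix d e assume "d \<in> A" "e \<in> A" "?p \<in> chart_dom d \<inter> chart_dom e"
    then show "(if e \<in> A \<and> ?p \<in> chart_dom e
          then frechet_derivative (transition c e) (at x) y else 0) =
        frechet_derivative (transition d e) (at (chart_map d ?p))
          (if d \<in> A \<and> ?p \<in> chart_dom d
           then frechet_derivative (transition c d) (at x) y else 0)"
      using coc[of d e] by (simp only: Int_iff simp_thms if_True)
  qed (use top in auto)
qed

lemma TM_eq_tvec:
  assumes "w \<in> TM X A" "c \<in> A" "fst w \<in> chart_dom c"
  shows "w = tvec A c (chart_map c (fst w)) (snd w c)"
proof -
  obtain p v where w: "w = (p, v)" by (rule prod.exhaust)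
  have v0: "v d = 0" if "d \<notin> A \<or> p \<notin> chart_dom d" for d
    using assms(1) that unfolding w TM_def by blast
  have v1: "v d = frechet_derivative (transition c d) (at (chart_map c p)) (v c)"
    if "d \<in> A" "p \<in> chart_dom d" for d
  proof -
    have "\<forall>c\<in>A. \<forall>d\<in>A. p \<in> chart_dom c \<inter> chart_dom d \<longrightarrow>
        v d = frechet_derivative (transition c d) (at (chart_map c p)) (v c)"
      using assms(1) unfolding w TM_def by blast
    then show ?thesis using assms(2,3) that unfolding w fst_conv by blast
  qed
  have "chart_inv c (chart_map c p) = p" using assms w by simp
  then show ?thesis unfolding w tvec_def fst_conv snd_conv prod.inject
    by (intro conjI ext) (use v0 v1 in \<open>simp_all only: split: if_split, auto\<close>)
qed

end

definition in_coords ::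
  "('m, 'n::finite) chart set \<Rightarrow> (('m, 'n) tvector \<Rightarrow> 'b) \<Rightarrow> ('m, 'n) chart
     \<Rightarrow> real^'n \<Rightarrow> real^'n \<Rightarrow> 'b" where
  "in_coords A f c x y = f (tvec A c x y)"

definition smooth_on_slit_TM ::
  "('m, 'n::finite) chart set \<Rightarrow> (('m, 'n) tvector \<Rightarrow> real) \<Rightarrow> bool" where
  "smooth_on_slit_TM A f \<longleftrightarrow>
     (\<forall>c\<in>A. smooth_on (chart_image c \<times> (- {0})) (\<lambda>(x, y). in_coords A f c x y))"


subsection \<open>Finsler metrics\<close>

text \<open>\<open>fibre_partial i f x y\<close> is \<open>\<partial>f/\<partial>y\<^sup>i\<close> at \<open>(x, y)\<close>.\<close>

definition fibre_partial ::
  "'n::finite \<Rightarrow> (real^'n \<Rightarrow> real^'n \<Rightarrow> real) \<Rightarrow> real^'n \<Rightarrow> real^'n \<Rightarrow> real" where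
  "fibre_partial i f x y = frechet_derivative (f x) (at y) (axis i 1)"

definition sym_pos_def :: "real^'n^'n \<Rightarrow> bool" where
  "sym_pos_def B \<longleftrightarrow> transpose B = B \<and> (\<forall>v. v \<noteq> 0 \<longrightarrow> v \<bullet> (B *v v) > 0)"

definition fund_tensor ::
  "('m, 'n::finite) chart set \<Rightarrow> (('m, 'n) tvector \<Rightarrow> real) \<Rightarrow> ('m, 'n) chart
     \<Rightarrow> real^'n \<Rightarrow> real^'n \<Rightarrow> real^'n^'n" where
  "fund_tensor A F c x y =
     (\<chi> i j. 1/2 * fibre_partial i (fibre_partial j (\<lambda>x y. (in_coords A F c x y)\<^sup>2)) x y)"

definition finsler_metric ::
  "'m topology \<Rightarrow> ('m, 'n::finite) chart set \<Rightarrow> (('m, 'n) tvector \<Rightarrow> real) \<Rightarrow> bool" where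
  "finsler_metric X A F \<longleftrightarrow>
     (\<forall>w\<in>TM X A. F w \<ge> 0) \<and>
     smooth_on_slit_TM A F \<and>
     (\<forall>w\<in>TM X A. \<forall>t>0. F (scale_tv t w) = t * F w) \<and>
     (\<forall>c\<in>A. \<forall>x\<in>chart_image c. \<forall>y. y \<noteq> 0 \<longrightarrow> sym_pos_def (fund_tensor A F c x y))"

definition cartan_torsion ::
  "('m, 'n::finite) chart set \<Rightarrow> (('m, 'n) tvector \<Rightarrow> real) \<Rightarrow> ('m, 'n) chart
     \<Rightarrow> 'n \<Rightarrow> 'n \<Rightarrow> 'n \<Rightarrow> real^'n \<Rightarrow> real^'n \<Rightarrow> real" where
  "cartan_torsion A F c i j k x y =
     1/2 * fibre_partial k (\<lambda>x y. fund_tensor A F c x y $ i $ j) x y"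

text \<open>For \<open>n \<ge> 2\<close> the vanishing of the Cartan torsion says that \<open>F\<^sup>2\<close> is a quadratic form on
  each tangent space. For \<open>n = 1\<close> it allows different quadratic forms on the two half-lines of a
  punctured tangent line, since \<open>F\<close> need not be reversible.\<close>

definition riemannian ::
  "('m, 'n::finite) chart set \<Rightarrow> (('m, 'n) tvector \<Rightarrow> real) \<Rightarrow> bool" where
  "riemannian A F \<longleftrightarrow>
     (\<forall>c\<in>A. \<forall>x\<in>chart_image c. \<forall>y. y \<noteq> 0 \<longrightarrow> (\<forall>i j k. cartan_torsion A F c i j k x y = 0))"


subsection \<open>AR-Finsler metrics\<close>

text \<open>Polynomials in \<open>y\<close> with coefficients depending on \<open>x\<close>: \<open>N\<close> is a finite set of
  multi-indices and \<open>p m\<close> is the coefficient of \<open>y\<^sup>m\<close>.\<close>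

definition poly_in_y ::
  "('n::finite \<Rightarrow> nat) set \<Rightarrow> (('n \<Rightarrow> nat) \<Rightarrow> real^'n \<Rightarrow> real)
     \<Rightarrow> real^'n \<Rightarrow> real^'n \<Rightarrow> real" where
  "poly_in_y N p x y = (\<Sum>m\<in>N. p m x * (\<Prod>i\<in>UNIV. (y $ i) ^ m i))"

definition rational_in_y ::
  "(real^'n::finite) set \<Rightarrow> (real^'n \<Rightarrow> real^'n \<Rightarrow> real) \<Rightarrow> bool" where
  "rational_in_y S f \<longleftrightarrow>
     (\<forall>x0\<in>S. \<exists>W N p q. open W \<and> x0 \<in> W \<and> W \<subseteq> S \<and> finite N \<and>
        (\<forall>m\<in>N. smooth_on W (p m) \<and> smooth_on W (q m)) \<and>
        (\<forall>x\<in>W. \<forall>y. y \<noteq> 0 \<longrightarrow>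
           poly_in_y N q x y \<noteq> 0 \<and> f x y = poly_in_y N p x y / poly_in_y N q x y))"

definition ar_finsler ::
  "'m topology \<Rightarrow> ('m, 'n::finite) chart set \<Rightarrow> (('m, 'n) tvector \<Rightarrow> real)
     \<Rightarrow> (('m, 'n) tvector \<Rightarrow> real) \<Rightarrow> (('m, 'n) chart \<Rightarrow> real^'n \<Rightarrow> real^'n \<Rightarrow> real^'n^'n)
     \<Rightarrow> bool" where
  "ar_finsler X A F \<eta> a \<longleftrightarrow>
     finsler_metric X A F \<and>
     (\<forall>w\<in>slit_TM X A. \<eta> w \<ge> 0) \<and> smooth_on_slit_TM A \<eta> \<and>
     (\<forall>c\<in>A. \<forall>i j. rational_in_y (chart_image c) (\<lambda>x y. a c x y $ i $ j)) \<and>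
     (\<forall>c\<in>A. \<forall>x\<in>chart_image c. \<forall>y. y \<noteq> 0 \<longrightarrow>
        sym_pos_def (a c x y) \<and>
        fund_tensor A F c x y = in_coords A \<eta> c x y *\<^sub>R a c x y \<and>
        (\<forall>i j. \<forall>t>0. in_coords A \<eta> c x (t *\<^sub>R y) * a c x (t *\<^sub>R y) $ i $ j
                      = in_coords A \<eta> c x y * a c x y $ i $ j))"

end

theory Submission
  imports Defs
begin

text \<open>Since \<open>g = \<eta> a\<close>, the condition says that the mean Cartan torsion
  \<open>g\<^sup>j\<^sup>k C\<^sub>i\<^sub>j\<^sub>k\<close> vanishes, and the nontrivial direction is Deicke's theorem. It is
  proved here by integration. Fix \<open>k\<close>, put \<open>u = g\<^sub>k\<^sub>k\<close>, \<open>h = g\<^sup>-\<^sup>1\<close> and \<open>C = \<partial>\<^sub>k g\<close>, where all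
  derivatives are taken along the fibre. Vanishing mean torsion and the symmetry of
  \<open>\<partial>\<^sub>k g\<^sub>i\<^sub>j\<close> make the rows of \<open>h\<close> divergence free, and differentiating
  \<open>tr (h C) = 0\<close> once more gives \<open>h\<^sup>i\<^sup>j \<partial>\<^sub>i \<partial>\<^sub>j u = tr (h C h C) \<ge> 0\<close>. By Euler's relations a cut-off
  \<open>\<psi>(F\<^sup>2)\<close> does not contribute to the divergence of \<open>\<psi>(F\<^sup>2) h \<nabla>u\<close>, which is therefore
  \<open>\<psi>(F\<^sup>2) tr (h C h C)\<close>. This field is supported in a compact annulus, so its divergence
  has integral zero; hence \<open>tr (h C h C) = 0\<close> and \<open>C = 0\<close>. No maximum principle is needed, and
  dimension one is not an exception.\<close>

subsection \<open>Smooth functions and their partial derivatives\<close>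

text \<open>A derivative at a point of an open set depends only on nearby values, so agreement on
  \<open>S\<close> passes to the derivatives of every order. The closure proofs below use this to
  replace the derivative of a compound function by its explicit formula.\<close>

lemma Ck_on_cong:
  assumes "open S" "\<And>x. x \<in> S \<Longrightarrow> f x = g x" "Ck_on k S f"
  shows "Ck_on k S g"
  using assms(2,3)
proof (induction k arbitrary: f g)
  case 0
  then show ?case by (simp cong: continuous_on_cong)
next
  case (Suc k)
  have d: "(g has_derivative frechet_derivative f (at x)) (at x)" if "x \<in> S" for x
    by (rule has_derivative_transform_within_open[of f, OF _ \<open>open S\<close> that])
      (use Suc.prems that in \<open>auto simp: frechet_derivative_works[symmetric]\<close>)
  have e: "frechet_derivative f (at x) b = frechet_derivative g (at x) b" if "x \<in> S" for x b
    using fun_cong[OF frechet_derivative_at[OF d[OF that]]] .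
  have "Ck_on k S (\<lambda>x. frechet_derivative g (at x) b)" if "b \<in> Basis" for b
    by (rule Suc.IH[OF e]) (use Suc.prems that in simp_all)
  moreover have "g differentiable (at x)" if "x \<in> S" for x
    using d[OF that] by (rule differentiableI)
  ultimately show ?case by simp
qed

text \<open>At order zero this is continuity of differentiable functions; higher orders follow by
  applying the claim to the derivatives. It serves the Leibniz rule, whose terms contain an
  undifferentiated factor.\<close>

lemma Ck_on_Suc_imp_Ck_on: "Ck_on (Suc k) S f \<Longrightarrow> Ck_on k S f"
proof (induction k arbitrary: f)
  case 0
  then show ?case
    by (auto intro!: continuous_at_imp_continuous_on differentiable_imp_continuous_within)
next
  case (Suc k)
  from Suc.prems have "\<forall>x\<in>S. f differentiable (at x)"
    and "\<forall>b\<in>Basis. Ck_on (Suc k) S (\<lambda>x. frechet_derivative f (at x) b)"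
    by (auto simp only: Ck_on.simps)
  then show ?case using Suc.IH by auto
qed

lemma Ck_on_add:
  assumes "open S" "Ck_on k S f" "Ck_on k S g"
  shows "Ck_on k S (\<lambda>x. f x + g x)"
  using assms(2,3)
proof (induction k arbitrary: f g)
  case 0
  then show ?case by (simp add: continuous_on_add)
next
  case (Suc k)
  have "Ck_on k S (\<lambda>x. frechet_derivative (\<lambda>x. f x + g x) (at x) b)" if "b \<in> Basis" for b
  proof (rule Ck_on_cong[OF \<open>open S\<close>])
    show "Ck_on k S (\<lambda>x. frechet_derivative f (at x) b + frechet_derivative g (at x) b)"
      using Suc that by simp
    show "frechet_derivative f (at x) b + frechet_derivative g (at x) b =
        frechet_derivative (\<lambda>x. f x + g x) (at x) b" if "x \<in> S" for x
    proof -
      have "((\<lambda>x. f x + g x) has_derivative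
          (\<lambda>h. frechet_derivative f (at x) h + frechet_derivative g (at x) h)) (at x)"
        using Suc.prems that
        by (intro has_derivative_add) (auto simp: frechet_derivative_works[symmetric])
      from fun_cong[OF frechet_derivative_at[OF this], of b] show ?thesis .
    qed
  qed
  then show ?case using Suc.prems by simp
qed

lemma Ck_on_mult:
  fixes f g :: "'a::euclidean_space \<Rightarrow> real"
  assumes "open S" "Ck_on k S f" "Ck_on k S g"
  shows "Ck_on k S (\<lambda>x. f x * g x)"
  using assms(2,3)
proof (induction k arbitrary: f g)
  case 0
  then show ?case by (simp add: continuous_on_mult)
next
  case (Suc k)
  have "Ck_on k S (\<lambda>x. frechet_derivative (\<lambda>x. f x * g x) (at x) b)" if b: "b \<in> Basis" for b
  proof (rule Ck_on_cong[OF \<open>open S\<close>])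
    show "Ck_on k S (\<lambda>x. f x * frechet_derivative g (at x) b + frechet_derivative f (at x) b * g x)"
      using Suc.prems b
      by (intro Ck_on_add[OF \<open>open S\<close>] Suc.IH Ck_on_Suc_imp_Ck_on[of k S f]
            Ck_on_Suc_imp_Ck_on[of k S g]) auto
    show "f x * frechet_derivative g (at x) b + frechet_derivative f (at x) b * g x =
        frechet_derivative (\<lambda>x. f x * g x) (at x) b" if "x \<in> S" for x
    proof -
      have "((\<lambda>x. f x * g x) has_derivative
          (\<lambda>h. f x * frechet_derivative g (at x) h + frechet_derivative f (at x) h * g x)) (at x)"
        using Suc.prems that
        by (intro has_derivative_mult) (auto simp: frechet_derivative_works[symmetric])
      from fun_cong[OF frechet_derivative_at[OF this], of b] show ?thesis .
    qed
  qed
  then show ?case using Suc.prems by simp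
qed

text \<open>The derivative of the slice in direction \<open>b\<close> is the total derivative in
  direction \<open>(0, b)\<close>, which is again a slice, of a function one order less smooth. It
  carries smoothness from a chart of the tangent bundle to a single tangent space.\<close>

lemma Ck_on_slice:
  assumes "open U" "open V" "x \<in> U" "Ck_on k (U \<times> V) f"
  shows "Ck_on k V (\<lambda>y. f (x, y))"
  using assms(4)
proof (induction k arbitrary: f)
  case 0
  then have "continuous_on (U \<times> V) f" by simp
  then have "continuous_on V (\<lambda>y. f (x, y))"
    by (rule continuous_on_compose2) (use \<open>x \<in> U\<close> in \<open>auto intro: continuous_on_Pair\<close>)
  then show ?case by simp
next
  case (Suc k)
  have d: "((\<lambda>y. f (x, y)) has_derivative (\<lambda>b. frechet_derivative f (at (x, y)) (0, b))) (at y)"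
    if "y \<in> V" for y
  proof -
    have 1: "((\<lambda>y. (x, y)) has_derivative (\<lambda>b. (0, b))) (at y)"
      by (intro has_derivative_Pair has_derivative_const has_derivative_ident)
    have 2: "(f has_derivative frechet_derivative f (at (x, y))) (at (x, y))"
      using Suc.prems that \<open>x \<in> U\<close> by (auto simp: frechet_derivative_works[symmetric])
    show ?thesis
      using diff_chain_at[OF 1 2] by (simp add: o_def)
  qed
  have "Ck_on k V (\<lambda>y. frechet_derivative (\<lambda>y. f (x, y)) (at y) b)" if "b \<in> Basis" for b
  proof (rule Ck_on_cong[OF \<open>open V\<close>])
    show "Ck_on k V (\<lambda>y. frechet_derivative f (at (x, y)) (0, b))"
    proof -
      have "(0, b) \<in> Basis" using that by (simp add: Basis_prod_def)
      with Suc.prems have "Ck_on k (U \<times> V) (\<lambda>p. frechet_derivative f (at p) (0, b))"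
        unfolding Ck_on.simps by blast
      then show ?thesis by (rule Suc.IH)
    qed
    show "frechet_derivative f (at (x, y)) (0, b) = frechet_derivative (\<lambda>y. f (x, y)) (at y) b"
      if "y \<in> V" for y
      using fun_cong[OF frechet_derivative_at[OF d[OF that]], of b] .
  qed
  moreover have "(\<lambda>y. f (x, y)) differentiable (at y)" if "y \<in> V" for y
    using d[OF that] by (rule differentiableI)
  ultimately show ?case by simp
qed

section \<open>Coordinate derivatives on a single Euclidean space and their symmetry\<close>

definition pd :: "'n::finite \<Rightarrow> (real^'n \<Rightarrow> real) \<Rightarrow> real^'n \<Rightarrow> real" where
  "pd i f y = frechet_derivative f (at y) (axis i 1)"

lemma pd_eqI: "(f has_derivative f') (at y) \<Longrightarrow> pd i f y = f' (axis i 1)"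
  unfolding pd_def using fun_cong[OF frechet_derivative_at] by metis

text \<open>Functions that agree near \<open>y\<close> have the same derivatives there, so
  \<open>frechet_derivative\<close>, a choice among these, also agrees.\<close>

lemma pd_cong:
  assumes "open S" "y \<in> S" "\<And>z. z \<in> S \<Longrightarrow> f z = g z"
  shows "pd i f y = pd i g y"
proof -
  have "(f has_derivative D) (at y) \<longleftrightarrow> (g has_derivative D) (at y)" for D
    using has_derivative_transform_within_open[OF _ assms(1,2)] assms(3) by metis
  then show ?thesis by (simp add: pd_def frechet_derivative_def)
qed

lemma frechet_derivative_eq_sum_pd:
  assumes "f differentiable (at y)"
  shows "frechet_derivative f (at y) v = (\<Sum>i\<in>UNIV. v $ i * pd i f y)"
proof -
  interpret bounded_linear "frechet_derivative f (at y)"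
    using assms has_derivative_bounded_linear frechet_derivative_works by blast
  have "frechet_derivative f (at y) (\<Sum>i\<in>UNIV. (v $ i) *\<^sub>R axis i 1) = (\<Sum>i\<in>UNIV. v $ i * pd i f y)"
    by (simp add: sum scaleR pd_def)
  then show ?thesis using basis_expansion[of v] by (simp add: scalar_mult_eq_scaleR)
qed

lemma smooth_on_imp_differentiable: "smooth_on S f \<Longrightarrow> y \<in> S \<Longrightarrow> f differentiable (at y)"
  unfolding smooth_on_def by (metis Ck_on.simps(2))

lemma smooth_on_imp_continuous_on: "smooth_on S f \<Longrightarrow> continuous_on S f"
  unfolding smooth_on_def by (metis Ck_on.simps(1))

lemma smooth_on_pd: "smooth_on S f \<Longrightarrow> smooth_on S (pd i f)"
proof -
  assume "smooth_on S f"
  then have "Ck_on (Suc k) S f" for k by (simp add: smooth_on_def)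
  moreover have "axis i 1 \<in> (Basis :: (real^_) set)" by simp
  ultimately have "Ck_on k S (\<lambda>x. frechet_derivative f (at x) (axis i 1))" for k
    unfolding Ck_on.simps by blast
  then show ?thesis by (simp add: smooth_on_def pd_def[abs_def])
qed

lemma pd_along_axis:
  assumes "f differentiable (at (z + t *\<^sub>R axis i 1))"
  shows "((\<lambda>t. f (z + t *\<^sub>R axis i 1)) has_real_derivative pd i f (z + t *\<^sub>R axis i 1)) (at t)"
proof -
  have 1: "(f has_derivative frechet_derivative f (at (z + t *\<^sub>R axis i 1))) (at (z + t *\<^sub>R axis i 1))"
    using assms by (simp add: frechet_derivative_works[symmetric])
  have 2: "((\<lambda>t. z + t *\<^sub>R axis i 1) has_derivative (\<lambda>h. h *\<^sub>R axis i 1)) (at t)"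
    by (rule derivative_eq_intros refl | simp)+
  interpret bounded_linear "frechet_derivative f (at (z + t *\<^sub>R axis i 1))"
    using 1 by (rule has_derivative_bounded_linear)
  show ?thesis
    using diff_chain_at[OF 2 1]
    by (simp add: o_def scaleR pd_def has_derivative_imp_has_field_derivative)
qed

text \<open>The mean value theorem is applied twice: along direction \<open>i\<close> to the
  difference of \<open>f\<close> over a step in direction \<open>j\<close>, then along
  \<open>j\<close> to \<open>pd i f\<close>. Both displacements are at most \<open>s\<close>, whence
  the radius \<open>2 * s\<close>.\<close>

lemma mixed_difference_mvt:
  fixes f :: "real^'n::finite \<Rightarrow> real"
  assumes "s > 0" "cball y (2 * s) \<subseteq> S" "\<And>z. z \<in> S \<Longrightarrow> f differentiable (at z)"
    "\<And>z. z \<in> S \<Longrightarrow> pd i f differentiable (at z)"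
  obtains z where "z \<in> cball y (2 * s)"
    "f (y + s *\<^sub>R axis i 1 + s *\<^sub>R axis j 1) - f (y + s *\<^sub>R axis i 1) - f (y + s *\<^sub>R axis j 1) + f y
      = s * s * pd j (pd i f) z"
proof -
  have inS: "y + t *\<^sub>R axis i 1 + r *\<^sub>R axis j 1 \<in> cball y (2 * s)"
    if "0 \<le> t" "t \<le> s" "0 \<le> r" "r \<le> s" for t r
  proof -
    have "norm (t *\<^sub>R axis i 1 + r *\<^sub>R axis j (1::real)) \<le> \<bar>t\<bar> + \<bar>r\<bar>"
      by (rule order.trans[OF norm_triangle_ineq]) simp
    moreover have "dist y (y + t *\<^sub>R axis i 1 + r *\<^sub>R axis j 1) = norm (t *\<^sub>R axis i 1 + r *\<^sub>R axis j (1::real))"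
      by (metis add.assoc add_diff_cancel_left' dist_commute dist_norm)
    ultimately show ?thesis using that by simp
  qed
  have inS': "y + t *\<^sub>R axis i 1 + r *\<^sub>R axis j 1 \<in> S" "y + r *\<^sub>R axis j 1 + t *\<^sub>R axis i 1 \<in> S"
    if "0 \<le> t" "t \<le> s" "0 \<le> r" "r \<le> s" for t r
    using subsetD[OF assms(2) inS[OF that]] by (simp_all add: add.assoc add.commute[of "t *\<^sub>R axis i 1"])
  \<comment> \<open>The second difference of \<open>f\<close> is the increment of
    \<open>\<phi>\<close> over \<open>[0, s]\<close>.\<close>
  define \<phi> where "\<phi> t = f ((y + s *\<^sub>R axis j 1) + t *\<^sub>R axis i 1) - f (y + t *\<^sub>R axis i 1)" for t
  have d1: "(\<phi> has_real_derivative
      pd i f (y + s *\<^sub>R axis j 1 + t *\<^sub>R axis i 1) - pd i f (y + t *\<^sub>R axis i 1)) (at t)"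
    if "0 \<le> t" "t \<le> s" for t
  proof -
    have "y + s *\<^sub>R axis j 1 + t *\<^sub>R axis i 1 \<in> S" "y + t *\<^sub>R axis i 1 \<in> S"
      using inS'(2)[of t s] inS'(1)[of t 0] that \<open>s > 0\<close> by simp_all
    then show ?thesis unfolding \<phi>_def by (intro DERIV_diff pd_along_axis[of f] assms(3))
  qed
  obtain t where t: "0 < t" "t < s" and e1: "\<phi> s - \<phi> 0 =
      (s - 0) * (pd i f (y + s *\<^sub>R axis j 1 + t *\<^sub>R axis i 1) - pd i f (y + t *\<^sub>R axis i 1))"
    using MVT2[OF \<open>s > 0\<close> d1] by metis
  define \<psi> where "\<psi> r = pd i f (y + t *\<^sub>R axis i 1 + r *\<^sub>R axis j 1)" for r
  have d2: "(\<psi> has_real_derivative pd j (pd i f) (y + t *\<^sub>R axis i 1 + r *\<^sub>R axis j 1)) (at r)"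
    if "0 \<le> r" "r \<le> s" for r
    unfolding \<psi>_def using inS'(1)[of t r] that t
    by (intro pd_along_axis[of "pd i f" "y + t *\<^sub>R axis i 1" r j] assms(4)) simp
  obtain r where r: "0 < r" "r < s" and e2:
    "\<psi> s - \<psi> 0 = (s - 0) * pd j (pd i f) (y + t *\<^sub>R axis i 1 + r *\<^sub>R axis j 1)"
    using MVT2[OF \<open>s > 0\<close> d2] by metis
  show ?thesis
  proof (rule that[of "y + t *\<^sub>R axis i 1 + r *\<^sub>R axis j 1"])
    show "y + t *\<^sub>R axis i 1 + r *\<^sub>R axis j 1 \<in> cball y (2 * s)" using inS t r by simp
    show "f (y + s *\<^sub>R axis i 1 + s *\<^sub>R axis j 1) - f (y + s *\<^sub>R axis i 1) - f (y + s *\<^sub>R axis j 1) + f y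
      = s * s * pd j (pd i f) (y + t *\<^sub>R axis i 1 + r *\<^sub>R axis j 1)"
      using e1 e2 by (simp add: \<phi>_def \<psi>_def add.assoc add.commute[of "s *\<^sub>R axis j 1"])
  qed
qed

text \<open>The second difference is symmetric in \<open>i\<close> and \<open>j\<close>. Divided by
  the squared step it is a value of either mixed derivative at points tending to \<open>y\<close>,
  and both are continuous.\<close>

lemma pd_commute:
  fixes f :: "real^'n::finite \<Rightarrow> real"
  assumes "open S" "smooth_on S f" "y \<in> S"
  shows "pd i (pd j f) y = pd j (pd i f) y"
proof -
  obtain e where e: "e > 0" "cball y e \<subseteq> S" using assms open_contains_cball by blast
  \<comment> \<open>The factor 1/2 keeps the balls of radius \<open>2 * s n\<close> inside
    \<open>cball y e\<close>.\<close>
  define s where "s n = e / 2 * inverse (real (Suc n))" for n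
  have s: "s n > 0" "2 * s n \<le> e" for n
    using e(1) by (auto simp: s_def field_simps)
  have S: "cball y (2 * s n) \<subseteq> S" for n using s[of n] e(2) by auto
  have "\<exists>z w. z \<in> cball y (2 * s n) \<and> w \<in> cball y (2 * s n) \<and> pd j (pd i f) z = pd i (pd j f) w" for n
  proof -
    obtain z where z: "z \<in> cball y (2 * s n)"
      "f (y + s n *\<^sub>R axis i 1 + s n *\<^sub>R axis j 1) - f (y + s n *\<^sub>R axis i 1) - f (y + s n *\<^sub>R axis j 1) + f y
      = s n * s n * pd j (pd i f) z"
      by (rule mixed_difference_mvt[OF s(1) S, of f i n j])
        (use assms in \<open>auto intro: smooth_on_imp_differentiable smooth_on_pd\<close>)
    obtain w where w: "w \<in> cball y (2 * s n)"
      "f (y + s n *\<^sub>R axis j 1 + s n *\<^sub>R axis i 1) - f (y + s n *\<^sub>R axis j 1) - f (y + s n *\<^sub>R axis i 1) + f y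
      = s n * s n * pd i (pd j f) w"
      by (rule mixed_difference_mvt[OF s(1) S, of f j n i])
        (use assms in \<open>auto intro: smooth_on_imp_differentiable smooth_on_pd\<close>)
    have swap: "y + s n *\<^sub>R axis j 1 + s n *\<^sub>R axis i 1 = y + s n *\<^sub>R axis i 1 + s n *\<^sub>R axis j 1"
      by (simp add: ac_simps)
    have "s n * s n * pd j (pd i f) z = s n * s n * pd i (pd j f) w"
      using w(2)[unfolded swap] z(2) by linarith
    then show ?thesis using z(1) w(1) s(1)[of n] by auto
  qed
  then obtain z w where zw: "\<And>n. z n \<in> cball y (2 * s n)" "\<And>n. w n \<in> cball y (2 * s n)"
    "\<And>n. pd j (pd i f) (z n) = pd i (pd j f) (w n)"
    by metis
  have "(\<lambda>n. 2 * s n) \<longlonglongrightarrow> 0"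
  proof -
    have "(\<lambda>n. e * inverse (real (Suc n))) \<longlonglongrightarrow> e * 0"
      by (intro tendsto_mult tendsto_const LIMSEQ_inverse_real_of_nat)
    then show ?thesis by (simp add: s_def)
  qed
  have lim: "v \<longlonglongrightarrow> y" if "\<And>n. v n \<in> cball y (2 * s n)" for v
  proof (rule tendsto_dist_iff[THEN iffD2])
    show "(\<lambda>n. dist (v n) y) \<longlonglongrightarrow> 0"
      by (rule tendsto_sandwich[OF _ _ tendsto_const \<open>(\<lambda>n. 2 * s n) \<longlonglongrightarrow> 0\<close>])
        (use that in \<open>simp_all add: dist_commute\<close>)
  qed
  have cont: "isCont (pd k (pd l f)) y" for k l
    using assms smooth_on_imp_continuous_on[OF smooth_on_pd[OF smooth_on_pd]]
    by (metis continuous_on_eq_continuous_at)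
  have "(\<lambda>n. pd j (pd i f) (z n)) \<longlonglongrightarrow> pd j (pd i f) y"
    using isCont_tendsto_compose[OF cont lim] zw(1) by blast
  moreover have "(\<lambda>n. pd j (pd i f) (z n)) \<longlonglongrightarrow> pd i (pd j f) y"
    unfolding zw(3) using isCont_tendsto_compose[OF cont lim] zw(2) by blast
  ultimately show ?thesis using LIMSEQ_unique by blast
qed

subsection \<open>Divergences of compactly supported fields\<close>

lemma pd_eq_0_of_locally_0:
  assumes "open U" "y \<in> U" "\<And>z. z \<in> U \<Longrightarrow> w z = 0"
  shows "pd i w y = 0"
  using pd_cong[OF assms(1,2), of w "\<lambda>_. 0" i] assms(3) by (simp add: pd_def)

text \<open>By translation invariance of Lebesgue measure every difference quotient of
  \<open>w\<close> has integral zero. The quotients converge pointwise to \<open>pd i w\<close>, and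
  dominated convergence carries the integral to the limit.\<close>

lemma integral_pd_eq_0:
  fixes w :: "real^'n::finite \<Rightarrow> real"
  assumes diff: "\<And>y. w differentiable (at y)"
    and cont: "continuous_on UNIV (pd i w)"
    and supp: "\<And>y. R < norm y \<Longrightarrow> w y = 0"
  shows "integrable lborel (pd i w)" "(\<integral>y. pd i w y \<partial>lborel) = 0"
proof -
  define e :: "real^'n" where "e = axis i 1"
  have [simp]: "norm e = 1" by (simp add: e_def)
  have supp': "pd i w y = 0" if "R < norm y" for y
    by (rule pd_eq_0_of_locally_0[of "{z. R < norm z}"])
      (use that supp in \<open>auto intro!: open_Collect_less continuous_intros\<close>)
  have contw: "continuous_on UNIV w"
    using diff by (simp add: continuous_on_eq_continuous_within differentiable_imp_continuous_within)
  have intw: "integrable lborel w"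
  proof -
    have "integrable lborel (\<lambda>x. indicator (cball 0 R) x *\<^sub>R w x)"
      using contw by (intro borel_integrable_compact) (auto intro: continuous_on_subset)
    moreover have "(\<lambda>x. indicator (cball 0 R) x *\<^sub>R w x) = w"
      using supp by (auto simp: indicator_def fun_eq_iff)
    ultimately show ?thesis by simp
  qed
  \<comment> \<open>The derivative is continuous, and it vanishes where \<open>w\<close> is locally
    zero; a bound on the ball of radius \<open>R\<close> is therefore global.\<close>
  obtain B where B: "\<And>y. \<bar>pd i w y\<bar> \<le> B"
  proof -
    have "bounded (pd i w ` cball 0 R)"
      using cont by (intro compact_imp_bounded compact_continuous_image) (auto intro: continuous_on_subset)
    then obtain B where B: "B > 0" "\<And>y. norm y \<le> R \<Longrightarrow> \<bar>pd i w y\<bar> \<le> B"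
      by (auto simp: bounded_pos)
    then have "\<bar>pd i w y\<bar> \<le> B" for y using supp'[of y] by (cases "norm y \<le> R") auto
    then show ?thesis using that by blast
  qed
  have along: "((\<lambda>t. w (y + t *\<^sub>R e)) has_real_derivative pd i w (y + t *\<^sub>R e)) (at t)" for y t
    unfolding e_def using diff by (rule pd_along_axis)
  \<comment> \<open>All steps have length at most 1, so the quotients vanish outside the ball of
    radius \<open>R + 1\<close>; inside it the mean value theorem bounds them by
    \<open>B\<close>.\<close>
  define s where "s n y = (w (y + inverse (real (Suc n)) *\<^sub>R e) - w y) / inverse (real (Suc n))" for n y
  have shift: "integrable lborel (\<lambda>y. w (y + c))" "(\<integral>y. w (y + c) \<partial>lborel) = (\<integral>y. w y \<partial>lborel)" for c
  proof -
    have m: "w \<in> borel_measurable borel" using contw by (rule borel_measurable_continuous_onI)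
    show "integrable lborel (\<lambda>y. w (y + c))"
      using integrable_distr[of "(+) c" lborel borel w] intw by (simp add: lborel_distr_plus add.commute)
    show "(\<integral>y. w (y + c) \<partial>lborel) = (\<integral>y. w y \<partial>lborel)"
      using integral_distr[of "(+) c" lborel borel w] m by (simp add: lborel_distr_plus add.commute)
  qed
  have s0: "(\<integral>y. s n y \<partial>lborel) = 0" for n
    unfolding s_def using shift intw by (simp add: Bochner_Integration.integral_diff)
  have lim: "(\<lambda>n. s n y) \<longlonglongrightarrow> pd i w y" for y
  proof -
    have "((\<lambda>h. (w (y + h *\<^sub>R e) - w y) / h) \<longlongrightarrow> pd i w y) (at 0)"
      using along[of y 0] by (simp add: DERIV_def)
    moreover have "filterlim (\<lambda>n. inverse (real (Suc n))) (at 0) sequentially"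
      using LIMSEQ_inverse_real_of_nat by (auto simp: filterlim_at)
    ultimately show ?thesis unfolding s_def by (rule filterlim_compose)
  qed
  have bound: "norm (s n y) \<le> B * indicator (cball 0 (R + 1)) y" for n y
  proof -
    define t where "t = inverse (real (Suc n))"
    have t: "0 < t" "t \<le> 1" by (auto simp: t_def field_simps)
    show ?thesis
    proof (cases "norm y \<le> R + 1")
      case True
      obtain z where "w (y + t *\<^sub>R e) - w (y + 0 *\<^sub>R e) = (t - 0) * pd i w (y + z *\<^sub>R e)"
        using MVT2[OF \<open>0 < t\<close>, of "\<lambda>t. w (y + t *\<^sub>R e)" "\<lambda>t. pd i w (y + t *\<^sub>R e)"] along by metis
      moreover have "s n y = (w (y + t *\<^sub>R e) - w y) / t" by (simp only: s_def t_def)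
      ultimately have "s n y = pd i w (y + z *\<^sub>R e)" using t by simp
      then show ?thesis using True B by simp
    next
      case False
      have "norm y \<le> norm (y + t *\<^sub>R e) + norm (t *\<^sub>R e)"
        using norm_triangle_ineq4[of "y + t *\<^sub>R e" "t *\<^sub>R e"] by simp
      then have "R < norm (y + t *\<^sub>R e)" using False t by simp
      then show ?thesis using False supp by (simp only: s_def t_def) simp
    qed
  qed
  have dom: "integrable lborel (\<lambda>y. B * indicator (cball 0 (R + 1)) y :: real)"
    by (intro integrable_mult_right integrable_real_indicator) (simp_all add: emeasure_bounded_finite[simplified])
  have ms: "s n \<in> borel_measurable lborel" for n
  proof -
    have "continuous_on UNIV (s n)" unfolding s_def
      by (intro continuous_intros continuous_on_compose2[OF contw]) auto
    then show ?thesis by (simp add: borel_measurable_continuous_onI)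
  qed
  have mp: "pd i w \<in> borel_measurable lborel"
    using cont by (simp add: borel_measurable_continuous_onI)
  show "integrable lborel (pd i w)"
    by (rule integrable_dominated_convergence[where s = s, OF mp ms dom]) (use lim bound in auto)
  have "(\<lambda>n. \<integral>y. s n y \<partial>lborel) \<longlonglongrightarrow> (\<integral>y. pd i w y \<partial>lborel)"
    by (rule integral_dominated_convergence[where s = s, OF mp ms dom]) (use lim bound in auto)
  then show "(\<integral>y. pd i w y \<partial>lborel) = 0" using s0 by (simp add: LIMSEQ_const_iff)
qed

text \<open>The divergence has integral zero, and a continuous nonnegative function with integral
  zero vanishes.\<close>

lemma nonneg_divergence_eq_0:
  fixes V :: "'n::finite \<Rightarrow> real^'n \<Rightarrow> real"
  assumes "\<And>i y. V i differentiable (at y)" "\<And>i. continuous_on UNIV (pd i (V i))"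
    and "\<And>i y. R < norm y \<Longrightarrow> V i y = 0"
    and nonneg: "\<And>y. 0 \<le> (\<Sum>i\<in>UNIV. pd i (V i) y)"
  shows "(\<Sum>i\<in>UNIV. pd i (V i) y) = 0"
proof -
  let ?q = "\<lambda>y. \<Sum>i\<in>UNIV. pd i (V i) y"
  note V = integral_pd_eq_0[OF assms(1-3)]
  have "integrable lborel ?q" using V(1) by auto
  moreover have "(\<integral>y. ?q y \<partial>lborel) = 0"
    using V by (subst Bochner_Integration.integral_sum) auto
  ultimately have q: "(?q has_integral 0) UNIV"
    using has_integral_integral_lborel[of ?q] by simp
  have cont: "continuous_on UNIV ?q" using assms(2) by (intro continuous_intros)
  \<comment> \<open>Vanishing at \<open>y\<close> is read off on a box around it: the integral over
    the box lies between 0 and the total integral.\<close>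
  obtain b where "y \<in> box (- b) b"
    using bounded_subset_box_symmetric[of "{y}"] by auto
  then obtain a where ab: "y \<in> box a b" by blast
  have int: "?q integrable_on cbox a b"
    by (rule integrable_continuous[OF continuous_on_subset[OF cont]]) simp
  have "integral (cbox a b) ?q \<le> integral UNIV ?q"
    using int q nonneg by (intro integral_subset_le) auto
  moreover have "0 \<le> integral (cbox a b) ?q" using nonneg int by (intro integral_nonneg) auto
  ultimately have "integral (cbox a b) ?q = 0" unfolding integral_unique[OF q] by (rule order_antisym)
  then have int0: "(?q has_integral 0) (cbox a b)"
    using integrable_integral[OF int] by metis
  have "continuous_on (cbox a b) ?q" by (rule continuous_on_subset[OF cont]) simp
  moreover have "box a b \<noteq> {}" using ab by auto
  moreover have "y \<in> cbox a b" using ab subsetD[OF box_subset_cbox] by blast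
  ultimately show ?thesis using nonneg int0
    by (intro has_integral_0_cbox_imp_0[of a b ?q y])
qed

subsection \<open>Positive definite matrices\<close>

text \<open>Cholesky decomposition by induction on the index set: the Schur complement of the pivot
  \<open>B p p\<close> is again positive semidefinite, and the pivot column supplies one further
  vector.\<close>

lemma psd_gram_decomposition:
  fixes B :: "'a \<Rightarrow> 'a \<Rightarrow> real"
  assumes "finite I" "\<And>i j. B i j = B j i" "\<And>x. 0 \<le> (\<Sum>i\<in>I. x i * (\<Sum>j\<in>I. B i j * x j))"
  shows "\<exists>v. \<forall>i\<in>I. \<forall>j\<in>I. B i j = (\<Sum>k\<in>I. v k i * v k j)"
  using assms
proof (induction I arbitrary: B rule: finite_induct)
  case empty
  then show ?case by simp
next
  case (insert p I)
  note fin = \<open>finite I\<close> and notin = \<open>p \<notin> I\<close> and sym = insert.prems(1)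
  \<comment> \<open>The Schur complement of the pivot. For a zero pivot division by zero makes it
    \<open>B\<close> itself, which is correct because the pivot column then vanishes, as
    \<open>col\<close> shows.\<close>
  define C where "C i j = B i j - B i p * B j p / B p p" for i j
  have expand: "(\<Sum>i\<in>insert p I. x i * (\<Sum>j\<in>insert p I. B i j * x j)) =
      B p p * (x p)\<^sup>2 + 2 * x p * (\<Sum>j\<in>I. B j p * x j) + (\<Sum>i\<in>I. x i * (\<Sum>j\<in>I. B i j * x j))" for x
  proof -
    have "(\<Sum>i\<in>insert p I. x i * (\<Sum>j\<in>insert p I. B i j * x j)) =
        x p * (B p p * x p + (\<Sum>j\<in>I. B p j * x j))
        + (\<Sum>i\<in>I. x i * (B i p * x p + (\<Sum>j\<in>I. B i j * x j)))"
      using fin notin by simp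
    moreover have "(\<Sum>j\<in>I. B p j * x j) = (\<Sum>j\<in>I. B j p * x j)"
      by (intro sum.cong refl arg_cong2[where f="(*)"] sym)
    moreover have "(\<Sum>i\<in>I. x i * (B i p * x p + (\<Sum>j\<in>I. B i j * x j))) =
        x p * (\<Sum>j\<in>I. B j p * x j) + (\<Sum>i\<in>I. x i * (\<Sum>j\<in>I. B i j * x j))"
      by (simp add: distrib_left sum.distrib sum_distrib_left mult_ac)
    ultimately show ?thesis
      by (simp add: algebra_simps power2_eq_square)
  qed
  note psd = insert.prems(2)[unfolded expand]
  have diag: "0 \<le> B p p"
  proof -
    define x where "x = (\<lambda>k. if k = p then 1 else (0::real))"
    have "x p = 1" "\<And>k. k \<in> I \<Longrightarrow> x k = 0" using notin by (auto simp: x_def)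
    then show ?thesis using psd[of x] by (simp cong: sum.cong)
  qed
  have col: "B i p = 0" if "B p p = 0" "i \<in> I" for i
  proof (rule ccontr)
    assume nz: "B i p \<noteq> 0"
    \<comment> \<open>With this \<open>t\<close> the form takes the value -1 at the vector with
      entries \<open>t\<close> at \<open>p\<close> and 1 at \<open>i\<close>.\<close>
    define t where "t = - (1 + B i i) / (2 * B i p)"
    have "i \<noteq> p" using that notin by auto
    define x where "x = (\<lambda>k. if k = p then t else if k = i then 1 else (0::real))"
    have x: "x p = t" "\<And>k. k \<in> I \<Longrightarrow> x k = (if k = i then 1 else 0)"
      using notin by (auto simp: x_def)
    have delta: "(\<Sum>j\<in>I. b j * x j) = b i" for b
    proof -
      have "(\<Sum>j\<in>I. b j * x j) = (\<Sum>j\<in>I. if j = i then b j else 0)"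
        by (intro sum.cong) (auto simp: x)
      then show ?thesis using fin that(2) by simp
    qed
    have "(\<Sum>k\<in>I. x k * (\<Sum>j\<in>I. B k j * x j)) = B i i"
      unfolding delta using delta[of "\<lambda>k. B k i"] by (simp add: mult.commute)
    with delta[of "\<lambda>j. B j p"] have "0 \<le> 2 * t * B i p + B i i"
      using psd[of x] that(1) x by simp
    moreover have "2 * t * B i p = - (1 + B i i)" using nz by (simp add: t_def field_simps)
    ultimately show False by simp
  qed
  have Cpsd: "0 \<le> (\<Sum>i\<in>I. x i * (\<Sum>j\<in>I. C i j * x j))" for x
  proof -
    define S where "S = (\<Sum>j\<in>I. B j p * x j)"
    \<comment> \<open>Completing the square: for a positive pivot this entry at \<open>p\<close>
      minimises the form, and the minimum is the form of the Schur complement.\<close>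
    define x' where "x' = x(p := - S / B p p)"
    have x': "x' p = - S / B p p" "\<And>k. k \<in> I \<Longrightarrow> x' k = x k"
      using notin by (auto simp: x'_def)
    have "0 \<le> B p p * (S / B p p)\<^sup>2 - 2 * (S / B p p) * S + (\<Sum>i\<in>I. x i * (\<Sum>j\<in>I. B i j * x j))"
      using psd[of x'] by (simp add: x' S_def cong: sum.cong)
    also have "B p p * (S / B p p)\<^sup>2 - 2 * (S / B p p) * S = - (S * S / B p p)"
      by (cases "B p p = 0") (simp_all add: field_simps power2_eq_square)
    also have "S * S / B p p = (\<Sum>i\<in>I. x i * (\<Sum>j\<in>I. B i p * B j p / B p p * x j))"
      unfolding S_def sum_product by (simp add: sum_distrib_left sum_divide_distrib mult_ac)
    also have "- \<dots> + (\<Sum>i\<in>I. x i * (\<Sum>j\<in>I. B i j * x j)) = (\<Sum>i\<in>I. x i * (\<Sum>j\<in>I. C i j * x j))"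
      by (simp add: C_def algebra_simps sum_subtractf)
    finally show ?thesis .
  qed
  have "C i j = C j i" for i j by (simp add: C_def sym[of i] mult.commute)
  from insert.IH[OF this Cpsd] obtain v where v: "\<forall>i\<in>I. \<forall>j\<in>I. C i j = (\<Sum>k\<in>I. v k i * v k j)"
    by blast
  \<comment> \<open>The new vector is the pivot column divided by the root of the pivot; the old
    vectors are extended by 0 at \<open>p\<close>.\<close>
  define v' where "v' k i = (if k = p then B i p / sqrt (B p p) else if i = p then 0 else v k i)" for k i
  have v'I: "(\<Sum>k\<in>I. v' k i * v' k j) = (if i = p \<or> j = p then 0 else \<Sum>k\<in>I. v k i * v k j)" for i j
    using notin by (auto simp: v'_def intro!: sum.cong sum.neutral)
  have root: "B i p / sqrt (B p p) * (B j p / sqrt (B p p)) = B i p * B j p / B p p" for i j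
    using diag by simp
  have "B i j = (\<Sum>k\<in>insert p I. v' k i * v' k j)" if "i \<in> insert p I" "j \<in> insert p I" for i j
  proof -
    have "(\<Sum>k\<in>insert p I. v' k i * v' k j) =
        B i p * B j p / B p p + (\<Sum>k\<in>I. v' k i * v' k j)"
      using fin notin root by (simp add: v'_def)
    also have "\<dots> = B i j"
    proof (cases "i = p \<or> j = p")
      case True
      then have "B i p * B j p / B p p = B i j"
        using col[of i] col[of j] that sym[of p j] by (cases "B p p = 0") auto
      then show ?thesis using True by (simp add: v'I)
    next
      case False
      then have "C i j = (\<Sum>k\<in>I. v k i * v k j)" using v that by blast
      then show ?thesis using False by (simp add: v'I C_def)
    qed
    finally show ?thesis ..
  qed
  then show ?case by blast
qed

lemma sym_pos_def_gram:
  fixes h :: "real^'n::finite^'n"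
  assumes "sym_pos_def h"
  obtains v :: "'n \<Rightarrow> real^'n" where "\<And>i j. h $ i $ j = (\<Sum>k\<in>UNIV. v k $ i * v k $ j)"
proof -
  have sym: "h $ i $ j = h $ j $ i" for i j
    using assms unfolding sym_pos_def_def transpose_def by (metis vec_lambda_beta)
  have psd: "0 \<le> (\<Sum>i\<in>UNIV. x i * (\<Sum>j\<in>UNIV. h $ i $ j * x j))" for x
  proof -
    have "0 \<le> (\<chi> i. x i) \<bullet> (h *v (\<chi> i. x i))"
      using assms by (cases "(\<chi> i. x i) = 0") (auto simp: sym_pos_def_def less_imp_le)
    then show ?thesis by (simp add: inner_vec_def matrix_vector_mult_def)
  qed
  obtain v :: "'n \<Rightarrow> 'n \<Rightarrow> real" where "\<forall>i\<in>UNIV. \<forall>j\<in>UNIV. h $ i $ j = (\<Sum>k\<in>UNIV. v k i * v k j)"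
    using psd_gram_decomposition[of UNIV "\<lambda>i j. h $ i $ j", OF _ sym psd] by auto
  then show ?thesis using that[of "\<lambda>k. \<chi> i. v k i"] by simp
qed

text \<open>The double sum is the trace of hGhG. Writing \<open>h\<close> as the sum of the products
  \<open>v k $ i * v k $ j\<close> turns it into a sum of values of the form \<open>h\<close> at the
  vectors \<open>G *v v k\<close>. If it is zero, all these vectors vanish, so Gh = 0, and
  invertibility of \<open>h\<close> gives G = 0.\<close>

lemma trace_square_nonneg:
  fixes h G :: "real^'n::finite^'n"
  assumes h: "sym_pos_def h" and G: "transpose G = G"
  shows "0 \<le> (\<Sum>i\<in>UNIV. \<Sum>j\<in>UNIV. (h ** G ** h) $ i $ j * G $ i $ j)"
    and "(\<Sum>i\<in>UNIV. \<Sum>j\<in>UNIV. (h ** G ** h) $ i $ j * G $ i $ j) = 0 \<Longrightarrow> h ** g = mat 1 \<Longrightarrow> G = 0"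
proof -
  let ?Q = "\<Sum>i\<in>UNIV. \<Sum>j\<in>UNIV. (h ** G ** h) $ i $ j * G $ i $ j"
  obtain v :: "'n \<Rightarrow> real^'n" where v: "\<And>i j. h $ i $ j = (\<Sum>k\<in>UNIV. v k $ i * v k $ j)"
    using sym_pos_def_gram[OF h] by blast
  have Q: "?Q = (\<Sum>k\<in>UNIV. (G *v v k) \<bullet> (h *v (G *v v k)))"
  proof -
    have "(h ** G ** h) $ i $ j = (\<Sum>k\<in>UNIV. ((h ** G) *v v k) $ i * v k $ j)" for i j
    proof -
      have "(h ** G ** h) $ i $ j = (\<Sum>b\<in>UNIV. \<Sum>k\<in>UNIV. (h ** G) $ i $ b * v k $ b * v k $ j)"
        by (simp add: matrix_matrix_mult_def[of "h ** G" h] v sum_distrib_left mult.assoc)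
      also have "\<dots> = (\<Sum>k\<in>UNIV. \<Sum>b\<in>UNIV. (h ** G) $ i $ b * v k $ b * v k $ j)"
        by (rule sum.swap)
      finally show ?thesis by (simp add: matrix_vector_mult_def[of "h ** G"] sum_distrib_right)
    qed
    then have "?Q = (\<Sum>i\<in>UNIV. \<Sum>j\<in>UNIV. \<Sum>k\<in>UNIV. ((h ** G) *v v k) $ i * v k $ j * G $ i $ j)"
      by (simp add: sum_distrib_right)
    also have "\<dots> = (\<Sum>i\<in>UNIV. \<Sum>k\<in>UNIV. \<Sum>j\<in>UNIV. ((h ** G) *v v k) $ i * v k $ j * G $ i $ j)"
      by (rule sum.cong[OF refl], rule sum.swap)
    also have "\<dots> = (\<Sum>k\<in>UNIV. \<Sum>i\<in>UNIV. \<Sum>j\<in>UNIV. ((h ** G) *v v k) $ i * v k $ j * G $ i $ j)"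
      by (rule sum.swap)
    also have "\<dots> = (\<Sum>k\<in>UNIV. \<Sum>i\<in>UNIV. (G *v v k) $ i * ((h ** G) *v v k) $ i)"
      by (simp add: matrix_vector_mult_def[of G] sum_distrib_left sum_distrib_right mult_ac)
    finally show ?thesis by (simp add: inner_vec_def matrix_vector_mul_assoc)
  qed
  have nn: "0 \<le> x \<bullet> (h *v x)" for x
    using h by (cases "x = 0") (auto simp: sym_pos_def_def less_imp_le)
  show "0 \<le> ?Q" unfolding Q by (intro sum_nonneg nn)
  show "G = 0" if "?Q = 0" "h ** g = mat 1"
  proof -
    have "(G *v v k) \<bullet> (h *v (G *v v k)) = 0" for k
      using that(1) unfolding Q by (subst (asm) sum_nonneg_eq_0_iff) (auto simp: nn)
    then have Gv: "G *v v k = 0" for k using h unfolding sym_pos_def_def by (metis less_irrefl)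
    have "(G ** h) $ i $ j = 0" for i j
    proof -
      have "(G ** h) $ i $ j = (\<Sum>b\<in>UNIV. \<Sum>k\<in>UNIV. G $ i $ b * v k $ b * v k $ j)"
        by (simp add: matrix_matrix_mult_def v sum_distrib_left mult.assoc)
      also have "\<dots> = (\<Sum>k\<in>UNIV. \<Sum>b\<in>UNIV. G $ i $ b * v k $ b * v k $ j)"
        by (rule sum.swap)
      also have "\<dots> = (\<Sum>k\<in>UNIV. (G *v v k) $ i * v k $ j)"
        by (simp add: matrix_vector_mult_def sum_distrib_right)
      finally show ?thesis by (simp add: Gv)
    qed
    then have "G ** h = 0" by (simp add: vec_eq_iff)
    then have "G ** (h ** g) = 0" by (simp add: matrix_mul_assoc)
    then show ?thesis using that(2) by simp
  qed
qed

text \<open>The form of \<open>h\<close> at \<open>x\<close> is the form of \<open>g\<close> at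
  \<open>h *v x\<close>, and \<open>h *v x\<close> is nonzero when \<open>x\<close> is.\<close>

lemma sym_pos_def_inverse:
  fixes g h :: "real^'n::finite^'n"
  assumes g: "sym_pos_def g" and hg: "h ** g = mat 1"
  shows "sym_pos_def h"
proof -
  have gh: "g ** h = mat 1" using hg matrix_left_right_inverse by blast
  have tg: "transpose g = g" using g by (simp add: sym_pos_def_def)
  have "transpose h = transpose h ** (g ** h)" using gh by simp
  also have "\<dots> = transpose (g ** h) ** h" by (simp add: matrix_transpose_mul tg matrix_mul_assoc)
  finally have th: "transpose h = h" using gh by (simp add: transpose_mat)
  have "0 < x \<bullet> (h *v x)" if "x \<noteq> 0" for x
  proof -
    have x: "g *v (h *v x) = x" by (simp add: matrix_vector_mul_assoc gh)
    then have "h *v x \<noteq> 0" using that by (metis matrix_vector_mult_0_right)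
    then have "0 < (h *v x) \<bullet> (g *v (h *v x))" using g by (simp add: sym_pos_def_def)
    then show ?thesis using x by (simp add: inner_commute)
  qed
  then show ?thesis using th by (simp add: sym_pos_def_def)
qed

lemma sym_pos_def_inverse_exists:
  fixes g :: "real^'n::finite^'n"
  assumes g: "sym_pos_def g"
  shows "matrix_inv g ** g = mat 1"
proof -
  have "\<forall>x. g *v x = 0 \<longrightarrow> x = 0"
    using g unfolding sym_pos_def_def by (metis inner_zero_right less_irrefl)
  then have "invertible g" by (meson invertible_left_inverse matrix_left_invertible_ker)
  then have "\<exists>h. g ** h = mat 1 \<and> h ** g = mat 1" by (simp add: invertible_def)
  from someI_ex[OF this] show ?thesis by (simp add: matrix_inv_def)
qed

subsection \<open>Calculus of partial derivatives\<close>

lemma pd_sum: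
  assumes "\<And>a. a \<in> I \<Longrightarrow> f a differentiable (at y)"
  shows "pd i (\<lambda>x. \<Sum>a\<in>I. f a x) y = (\<Sum>a\<in>I. pd i (f a) y)"
  unfolding pd_def[of i "f _"] using assms
  by (intro pd_eqI has_derivative_sum) (simp_all add: frechet_derivative_works[symmetric])

lemma pd_mult:
  assumes "f differentiable (at y)" "g differentiable (at y)"
  shows "pd i (\<lambda>x. f x * g x) y = f y * pd i g y + pd i f y * g y"
  unfolding pd_def[of i f] pd_def[of i g] using assms
  by (intro pd_eqI has_derivative_mult) (simp_all add: frechet_derivative_works[symmetric])

lemma pd_cmult: "f differentiable (at y) \<Longrightarrow> pd i (\<lambda>x. c * f x) y = c * pd i f y"
  using pd_mult[of "\<lambda>_. c" y f i] by (simp add: pd_def[of i "\<lambda>_. c"])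

lemma has_derivative_compose_real:
  assumes "(\<psi> has_real_derivative d) (at (f y))" "f differentiable (at y)"
  shows "((\<lambda>y. \<psi> (f y)) has_derivative (\<lambda>v. d * frechet_derivative f (at y) v)) (at y)"
proof -
  have 1: "(f has_derivative frechet_derivative f (at y)) (at y)"
    using assms(2) by (simp add: frechet_derivative_works[symmetric])
  have 2: "(\<psi> has_derivative (*) d) (at (f y))"
    using assms(1) by (simp add: has_field_derivative_def)
  show ?thesis using diff_chain_at[OF 1 2] by (simp add: o_def)
qed

lemma pd_compose_real:
  assumes "(\<psi> has_real_derivative d) (at (f y))" "f differentiable (at y)"
  shows "pd i (\<lambda>y. \<psi> (f y)) y = d * pd i f y"
  unfolding pd_def[of i f] by (rule pd_eqI[OF has_derivative_compose_real[OF assms]])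

lemma differentiable_transform_open:
  assumes "f differentiable (at y)" "open S" "y \<in> S" "\<And>z. z \<in> S \<Longrightarrow> f z = g z"
  shows "g differentiable (at y)"
  using assms unfolding differentiable_def by (metis has_derivative_transform_within_open)

lemma differentiable_prod:
  fixes f :: "'i \<Rightarrow> 'a::real_normed_vector \<Rightarrow> real"
  assumes "\<And>i. i \<in> I \<Longrightarrow> f i differentiable (at y)"
  shows "(\<lambda>x. \<Prod>i\<in>I. f i x) differentiable (at y)"
  using assms by (induction I rule: infinite_finite_induct) (auto intro: differentiable_mult)

lemma differentiable_det:
  fixes A :: "'a::real_normed_vector \<Rightarrow> real^'n::finite^'n"
  assumes "\<And>i j. (\<lambda>x. A x $ i $ j) differentiable (at y)"
  shows "(\<lambda>x. det (A x)) differentiable (at y)"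
  unfolding det_def using assms
  by (intro differentiable_sum ballI differentiable_mult differentiable_const differentiable_prod finite_permutations) auto

text \<open>Regularity of the inverse comes from Cramer's rule: its entries are quotients of
  determinants in the entries of \<open>G\<close>.\<close>

lemma differentiable_matrix_left_inverse:
  fixes G h :: "'a::real_normed_vector \<Rightarrow> real^'n::finite^'n"
  assumes "open S" "y \<in> S" "\<And>z. z \<in> S \<Longrightarrow> h z ** G z = mat 1"
    and G: "\<And>i j. (\<lambda>x. G x $ i $ j) differentiable (at y)"
  shows "(\<lambda>x. h x $ i $ j) differentiable (at y)"
proof (rule differentiable_transform_open[OF _ assms(1,2)])
  \<comment> \<open>The numerator matrix of Cramer's rule: column \<open>i\<close> of
    \<open>G\<close> is replaced by the unit vector \<open>axis j 1\<close>.\<close>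
  define N where "N x = (\<chi> a b. if b = i then (axis j 1 :: real^'n) $ a else G x $ a $ b)" for x
  have det: "det (G z) \<noteq> 0" if "z \<in> S" for z
    using assms(3)[OF that] invertible_det_nz invertible_left_inverse by blast
  have "(\<lambda>x. N x $ a $ b) differentiable (at y)" for a b
    using G by (cases "b = i") (simp_all add: N_def)
  then show "(\<lambda>x. det (N x) / det (G x)) differentiable (at y)"
    using det[OF \<open>y \<in> S\<close>] by (intro differentiable_divide differentiable_det G) auto
  show "det (N z) / det (G z) = h z $ i $ j" if "z \<in> S" for z
  proof -
    have "G z ** h z = mat 1" using assms(3)[OF that] matrix_left_right_inverse by blast
    then have "G z *v (h z *v axis j 1) = axis j 1" by (simp add: matrix_vector_mul_assoc)
    then have "h z *v axis j 1 = (\<chi> k. det (\<chi> a b. if b = k then (axis j 1 :: real^'n) $ a else G z $ a $ b) / det (G z))"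
      using cramer[OF det[OF that]] by blast
    moreover have "(h z *v axis j 1) $ i = h z $ i $ j"
      by (simp add: matrix_vector_mult_def axis_def if_distrib cong: if_cong)
    ultimately show ?thesis by (simp add: N_def)
  qed
qed

text \<open>Differentiate hG = 1 and multiply by \<open>h\<close> from the right.\<close>

lemma pd_matrix_left_inverse:
  fixes G h :: "real^'n::finite \<Rightarrow> real^'n^'n"
  assumes S: "open S" "y \<in> S" and inv: "\<And>z. z \<in> S \<Longrightarrow> h z ** G z = mat 1"
    and G: "\<And>i j. (\<lambda>x. G x $ i $ j) differentiable (at y)"
  shows "pd k (\<lambda>x. h x $ i $ j) y = - (h y ** (\<chi> a b. pd k (\<lambda>x. G x $ a $ b) y) ** h y) $ i $ j"
proof -
  note dh = differentiable_matrix_left_inverse[OF assms]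
  define Dh where "Dh = (\<chi> a b. pd k (\<lambda>x. h x $ a $ b) y)"
  define DG where "DG = (\<chi> a b. pd k (\<lambda>x. G x $ a $ b) y)"
  have "Dh ** G y + h y ** DG = 0"
  proof -
    have "(Dh ** G y + h y ** DG) $ a $ b = 0" for a b
    proof -
      have "(Dh ** G y + h y ** DG) $ a $ b = pd k (\<lambda>x. \<Sum>l\<in>UNIV. h x $ a $ l * G x $ l $ b) y"
        by (simp add: pd_sum pd_mult dh G Dh_def DG_def matrix_matrix_mult_def sum.distrib)
      also have "\<dots> = pd k (\<lambda>x. (mat 1 :: real^'n^'n) $ a $ b) y"
        by (rule pd_cong[OF S]) (simp add: inv[symmetric] matrix_matrix_mult_def)
      finally show ?thesis by (simp add: pd_def)
    qed
    then show ?thesis by (simp add: vec_eq_iff)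
  qed
  then have e: "Dh ** G y = - (h y ** DG)" by (rule eq_neg_iff_add_eq_0[THEN iffD2])
  have "G y ** h y = mat 1" using inv[OF S(2)] matrix_left_right_inverse by blast
  then have "Dh = (Dh ** G y) ** h y" by (simp add: matrix_mul_assoc[symmetric])
  also have "\<dots> = - (h y ** DG ** h y)"
    unfolding e by (simp add: vec_eq_iff matrix_matrix_mult_def sum_negf)
  finally have "Dh $ i $ j = (- (h y ** DG ** h y)) $ i $ j" by simp
  then show ?thesis by (simp add: Dh_def DG_def)
qed

text \<open>The chain rule for scaling. The factor \<open>t\<close> stays on the left because the
  exponent \<open>d - 1\<close> would be truncated for \<open>d = 0\<close>, a case used for third
  derivatives.\<close>

lemma pd_homogeneous:
  fixes f :: "real^'n::finite \<Rightarrow> real"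
  assumes hom: "\<And>t y. t > 0 \<Longrightarrow> y \<noteq> 0 \<Longrightarrow> f (t *\<^sub>R y) = t ^ d * f y"
    and diff: "\<And>y. y \<noteq> 0 \<Longrightarrow> f differentiable (at y)" and "t > 0" "y \<noteq> 0"
  shows "t * pd i f (t *\<^sub>R y) = t ^ d * pd i f y"
proof -
  have 1: "((\<lambda>y. t *\<^sub>R y) has_derivative (\<lambda>v. t *\<^sub>R v)) (at y)"
    by (intro has_derivative_scaleR_right has_derivative_ident)
  have 2: "(f has_derivative frechet_derivative f (at (t *\<^sub>R y))) (at (t *\<^sub>R y))"
    using diff assms by (simp add: frechet_derivative_works[symmetric])
  interpret D: bounded_linear "frechet_derivative f (at (t *\<^sub>R y))"
    using 2 by (rule has_derivative_bounded_linear)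
  have "pd i (f \<circ> (\<lambda>y. t *\<^sub>R y)) y = t * pd i f (t *\<^sub>R y)"
    using pd_eqI[OF diff_chain_at[OF 1 2], of i] by (simp add: pd_def D.scaleR)
  moreover have "pd i (f \<circ> (\<lambda>y. t *\<^sub>R y)) y = pd i (\<lambda>y. t ^ d * f y) y"
    using assms by (intro pd_cong[of "- {0}"]) (auto simp: hom)
  ultimately show ?thesis using pd_cmult[OF diff[OF \<open>y \<noteq> 0\<close>]] by simp
qed

text \<open>Both sides are the derivative of f(ty) with respect to \<open>t\<close> at 1, once by
  the chain rule and once by homogeneity.\<close>

lemma euler_homogeneous:
  fixes f :: "real^'n::finite \<Rightarrow> real"
  assumes hom: "\<And>t. t > 0 \<Longrightarrow> f (t *\<^sub>R y) = t ^ d * f y" and diff: "f differentiable (at y)"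
  shows "(\<Sum>i\<in>UNIV. y $ i * pd i f y) = real d * f y"
proof -
  have 1: "((\<lambda>t. t *\<^sub>R y) has_derivative (\<lambda>h. h *\<^sub>R y)) (at 1)"
    by (intro has_derivative_scaleR_left has_derivative_ident)
  have 2: "(f has_derivative frechet_derivative f (at y)) (at (1 *\<^sub>R y))"
    using diff by (simp add: frechet_derivative_works[symmetric])
  interpret D: bounded_linear "frechet_derivative f (at y)"
    using 2 by (rule has_derivative_bounded_linear)
  have "((\<lambda>t. f (t *\<^sub>R y)) has_real_derivative frechet_derivative f (at y) y) (at 1)"
    using diff_chain_at[OF 1 2] by (simp add: o_def D.scaleR has_derivative_imp_has_field_derivative)
  moreover have "((\<lambda>t. f (t *\<^sub>R y)) has_real_derivative real d * f y) (at 1)"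
  proof (rule has_field_derivative_transform_within_open)
    show "((\<lambda>t. t ^ d * f y) has_real_derivative real d * f y) (at 1)"
      by (rule derivative_eq_intros refl | simp)+
  qed (use hom in \<open>auto intro: open_greaterThan[of 0]\<close>)
  ultimately show ?thesis
    using DERIV_unique frechet_derivative_eq_sum_pd[OF diff] by metis
qed

text \<open>A C^1 cut-off, positive exactly between 1 and 2. One continuous derivative suffices,
  since the field it multiplies is differentiated once.\<close>

definition bump :: "real \<Rightarrow> real" where
  "bump s = (max 0 ((s - 1) * (2 - s)))\<^sup>2"

definition bump' :: "real \<Rightarrow> real" where
  "bump' s = 2 * max 0 ((s - 1) * (2 - s)) * (3 - 2 * s)"

lemma DERIV_max_0_power2: "((\<lambda>p::real. (max 0 p)\<^sup>2) has_real_derivative 2 * max 0 p) (at p)"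
proof -
  consider "p > 0" | "p < 0" | "p = 0" by linarith
  then show ?thesis
  proof cases
    case 1
    show ?thesis
    proof (rule has_field_derivative_transform_within_open[of "\<lambda>p. p\<^sup>2" _ _ "{0<..}"])
      show "((\<lambda>p. p\<^sup>2) has_real_derivative 2 * max 0 p) (at p)"
        using 1 by (auto intro!: derivative_eq_intros)
    qed (use 1 in auto)
  next
    case 2
    show ?thesis
      by (rule has_field_derivative_transform_within_open[of "\<lambda>p. 0" _ _ "{..<0}"]) (use 2 in auto)
  next
    case 3
    \<comment> \<open>At the kink the difference quotient is bounded by the modulus of the
      increment.\<close>
    have "((\<lambda>h::real. (max 0 h)\<^sup>2 / h) \<longlongrightarrow> 0) (at 0)"
    proof (rule Lim_null_comparison)
      show "((\<lambda>h::real. \<bar>h\<bar>) \<longlongrightarrow> 0) (at 0)" by (intro tendsto_eq_intros) auto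
      show "\<forall>\<^sub>F h::real in at 0. norm ((max 0 h)\<^sup>2 / h) \<le> \<bar>h\<bar>"
        by (intro always_eventually allI) (auto simp: max_def power2_eq_square)
    qed
    then show ?thesis using 3 by (simp add: DERIV_def)
  qed
qed

lemma DERIV_bump: "(bump has_real_derivative bump' s) (at s)"
proof -
  have "((\<lambda>s. (s - 1) * (2 - s)) has_real_derivative 3 - 2 * s) (at s)"
    by (auto intro!: derivative_eq_intros)
  from DERIV_chain2[OF DERIV_max_0_power2 this] show ?thesis
    by (simp add: bump_def[abs_def] bump'_def)
qed

lemma continuous_on_bump': "continuous_on UNIV bump'"
  unfolding bump'_def by (intro continuous_intros)

lemma bump_eq_0:
  assumes "s \<le> 1 \<or> 2 \<le> s"
  shows "bump s = 0"
proof -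
  have "(s - 1) * (2 - s) \<le> 0"
    using assms by (auto intro: mult_nonneg_nonpos mult_nonpos_nonneg)
  then show ?thesis by (simp add: bump_def max_def)
qed

lemma bump_nonneg: "0 \<le> bump s"
  by (simp add: bump_def)

subsection \<open>Deicke's theorem\<close>

text \<open>The function \<open>f\<close> plays the role of F^2 on one tangent space. Its Hessian is
  then twice the fundamental tensor, and \<open>h\<close> is the inverse of that Hessian.\<close>

context
  fixes f :: "real^'n::finite \<Rightarrow> real" and h :: "real^'n \<Rightarrow> real^'n^'n"
  assumes smooth: "smooth_on (- {0}) f"
    and hom: "\<And>t y. t > 0 \<Longrightarrow> y \<noteq> 0 \<Longrightarrow> f (t *\<^sub>R y) = t ^ 2 * f y"
    and pos: "\<And>y. y \<noteq> 0 \<Longrightarrow> sym_pos_def (\<chi> i j. pd i (pd j f) y)"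
    and inv: "\<And>y. y \<noteq> 0 \<Longrightarrow> h y ** (\<chi> i j. pd i (pd j f) y) = mat 1"
begin

section \<open>Symmetry and homogeneity of the higher derivatives\<close>

lemma open_slit: "open (- {0 :: real^'n})"
  by (rule open_Compl) simp

lemma smooth_pd2: "smooth_on (- {0}) (pd i (pd j f))"
  by (intro smooth_on_pd smooth)

lemma slit_differentiable:
  assumes "y \<noteq> 0"
  shows "f differentiable (at y)" "pd j f differentiable (at y)"
    "pd i (pd j f) differentiable (at y)" "pd k (pd i (pd j f)) differentiable (at y)"
  using assms by (auto intro!: smooth_on_imp_differentiable[of "- {0}"] smooth smooth_on_pd)

lemma pd2_sym: "y \<noteq> 0 \<Longrightarrow> pd i (pd j f) y = pd j (pd i f) y"
  by (rule pd_commute[OF open_slit smooth]) simp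

lemma pd3_sym:
  assumes "y \<noteq> 0"
  shows "pd k (pd i (pd j f)) y = pd i (pd k (pd j f)) y"
    "pd k (pd i (pd j f)) y = pd k (pd j (pd i f)) y"
proof -
  show "pd k (pd i (pd j f)) y = pd i (pd k (pd j f)) y"
    by (rule pd_commute[OF open_slit smooth_on_pd[OF smooth]]) (use assms in simp)
  show "pd k (pd i (pd j f)) y = pd k (pd j (pd i f)) y"
    by (rule pd_cong[OF open_slit]) (use assms pd2_sym in auto)
qed

text \<open>This recognises second derivatives of a diagonal Hessian entry as Hessian entries
  differentiated twice along \<open>k\<close>, the form in which a trace identity can be
  differentiated.\<close>

lemma pd4_sym:
  assumes "y \<noteq> 0"
  shows "pd i (pd j (pd k (pd k f))) y = pd k (pd k (pd i (pd j f))) y"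
proof -
  have "pd i (pd j (pd k (pd k f))) y = pd i (pd k (pd k (pd j f))) y"
    by (rule pd_cong[OF open_slit]) (use assms pd3_sym in \<open>auto\<close>)
  also have "\<dots> = pd k (pd i (pd k (pd j f))) y"
    by (rule pd_commute[OF open_slit smooth_pd2]) (use assms in simp)
  also have "\<dots> = pd k (pd k (pd i (pd j f))) y"
    by (rule pd_cong[OF open_slit]) (use assms pd3_sym(1) in auto)
  finally show ?thesis .
qed

text \<open>The exponent is displayed as \<open>t ^ 1\<close> here and as \<open>t ^ 0\<close> below
  to match the degree \<open>d\<close> in \<open>pd_homogeneous\<close> and
  \<open>euler_homogeneous\<close>.\<close>

lemma pd_hom: "t > 0 \<Longrightarrow> y \<noteq> 0 \<Longrightarrow> pd i f (t *\<^sub>R y) = t ^ 1 * pd i f y"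
  using pd_homogeneous[of f 2 t y i] hom slit_differentiable by (simp add: power2_eq_square)

lemma pd2_hom: "t > 0 \<Longrightarrow> y \<noteq> 0 \<Longrightarrow> pd i (pd j f) (t *\<^sub>R y) = t ^ 0 * pd i (pd j f) y"
  using pd_homogeneous[of "pd j f" 1 t y i] pd_hom slit_differentiable by simp

lemma pd3_hom: "t > 0 \<Longrightarrow> y \<noteq> 0 \<Longrightarrow> t * pd k (pd i (pd j f)) (t *\<^sub>R y) = pd k (pd i (pd j f)) y"
  using pd_homogeneous[of "pd i (pd j f)" 0 t y k] pd2_hom slit_differentiable by simp

section \<open>Euler relations and growth of the metric function\<close>

abbreviation "Hess y \<equiv> (\<chi> i j. pd i (pd j f) y)"
abbreviation "Third k y \<equiv> (\<chi> i j. pd k (pd i (pd j f)) y)"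

text \<open>Euler's relation for the first derivatives, which are homogeneous of degree one.\<close>

lemma gradient_eq:
  assumes "y \<noteq> 0"
  shows "(\<chi> i. pd i f y) = Hess y *v y"
proof -
  have "pd i f y = (\<Sum>j\<in>UNIV. pd i (pd j f) y * y $ j)" for i
    using euler_homogeneous[of "pd i f" y 1] pd_hom assms slit_differentiable pd2_sym[OF assms, of i]
    by (simp add: mult.commute)
  then show ?thesis by (simp add: vec_eq_iff matrix_vector_mult_def)
qed

text \<open>By Euler's relations in degrees two and one, \<open>2 * f y\<close> is the Hessian form
  evaluated at \<open>y\<close>.\<close>

lemma f_pos:
  assumes "y \<noteq> 0"
  shows "0 < f y"
proof -
  have "2 * f y = y \<bullet> (\<chi> i. pd i f y)"
    using euler_homogeneous[of f y 2] hom assms slit_differentiable by (simp add: inner_vec_def)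
  also have "\<dots> > 0" using pos[OF assms] assms by (simp add: gradient_eq sym_pos_def_def)
  finally show ?thesis by simp
qed

text \<open>The constants are the extrema of \<open>f\<close> on the unit sphere, spread to all
  vectors by homogeneity. They make the shell where \<open>f\<close> lies between 1 and 2 bounded
  and keep it away from the origin.\<close>

lemma f_bounds:
  obtains m M where "0 < m" "0 < M" "\<And>y. y \<noteq> 0 \<Longrightarrow> m * (norm y)\<^sup>2 \<le> f y" "\<And>y. y \<noteq> 0 \<Longrightarrow> f y \<le> M * (norm y)\<^sup>2"
proof -
  let ?S = "sphere (0 :: real^'n) 1"
  have c: "continuous_on ?S f"
    by (rule continuous_on_subset[OF smooth_on_imp_continuous_on[OF smooth]]) auto
  \<comment> \<open>Index types are nonempty, so the sphere contains a coordinate vector.\<close>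
  have "axis undefined 1 \<in> ?S" by simp
  then have ne: "?S \<noteq> {}" by blast
  obtain a b where a: "a \<in> ?S" "\<forall>y\<in>?S. f a \<le> f y" and b: "b \<in> ?S" "\<forall>y\<in>?S. f y \<le> f b"
    using continuous_attains_inf[OF compact_sphere ne c] continuous_attains_sup[OF compact_sphere ne c]
    by blast
  have nz: "a \<noteq> 0" "b \<noteq> 0" using a b by auto
  have s: "f y = (norm y)\<^sup>2 * f (y /\<^sub>R norm y)" "y /\<^sub>R norm y \<in> ?S" if "y \<noteq> 0" for y
    using hom[of "norm y" "y /\<^sub>R norm y"] that by simp_all
  show ?thesis
  proof (rule that[of "f a" "f b"])
    show "f a * (norm y)\<^sup>2 \<le> f y" if "y \<noteq> 0" for y
      using s[OF that] a(2) by (metis mult.commute mult_left_mono zero_le_power2)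
    show "f y \<le> f b * (norm y)\<^sup>2" if "y \<noteq> 0" for y
      using s[OF that] b(2) by (metis mult.commute mult_left_mono zero_le_power2)
  qed (use f_pos nz in auto)
qed

section \<open>The inverse Hessian and the cut-off field\<close>

lemma h_pos: "y \<noteq> 0 \<Longrightarrow> sym_pos_def (h y)"
  using sym_pos_def_inverse[OF pos inv] .

lemma h_differentiable:
  assumes "y \<noteq> 0"
  shows "(\<lambda>x. h x $ i $ j) differentiable (at y)"
  by (rule differentiable_matrix_left_inverse[OF open_slit, where G = Hess])
    (use assms inv slit_differentiable in auto)

lemma pd_h:
  assumes "y \<noteq> 0"
  shows "pd k (\<lambda>x. h x $ i $ j) y = - (h y ** Third k y ** h y) $ i $ j"
  using pd_matrix_left_inverse[OF open_slit, of y h Hess k i j] assms inv slit_differentiable by simp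

lemma continuous_on_h: "continuous_on (- {0}) (\<lambda>x. h x $ i $ j)"
  using h_differentiable
  by (intro continuous_at_imp_continuous_on) (auto intro: differentiable_imp_continuous_within)

text \<open>Cutting off by a function of \<open>f\<close> itself is essential: \<open>h\<close> maps the gradient of \<open>f\<close> to
  the radial field, which annihilates the 0-homogeneous function \<open>pd k (pd k f)\<close>.\<close>

definition flux0 :: "'n \<Rightarrow> 'n \<Rightarrow> real^'n \<Rightarrow> real" where
  "flux0 k i y = bump (f y) * (\<Sum>j\<in>UNIV. h y $ i $ j * pd j (pd k (pd k f)) y)"

text \<open>The hypotheses say nothing about \<open>f\<close> and \<open>h\<close> at the origin. As
  \<open>flux0\<close> vanishes at all small nonzero vectors, the value 0 gives a C^1 field on the
  whole space.\<close>

definition flux :: "'n \<Rightarrow> 'n \<Rightarrow> real^'n \<Rightarrow> real" where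
  "flux k i y = (if y = 0 then 0 else flux0 k i y)"

section \<open>Regularity and support of the field\<close>

lemma bump_f_differentiable: "y \<noteq> 0 \<Longrightarrow> (\<lambda>x. bump (f x)) differentiable (at y)"
  using has_derivative_compose_real[OF DERIV_bump slit_differentiable(1)] by (rule differentiableI)

lemma flux0_differentiable: "y \<noteq> 0 \<Longrightarrow> flux0 k i differentiable (at y)"
  unfolding flux0_def[abs_def]
  by (intro differentiable_mult bump_f_differentiable differentiable_sum ballI h_differentiable
      slit_differentiable) auto

lemma pd_flux0:
  assumes "y \<noteq> 0"
  shows "pd l (flux0 k i) y = bump (f y) * (\<Sum>j\<in>UNIV. h y $ i $ j * pd l (pd j (pd k (pd k f))) y
        - (h y ** Third l y ** h y) $ i $ j * pd j (pd k (pd k f)) y)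
      + bump' (f y) * pd l f y * (\<Sum>j\<in>UNIV. h y $ i $ j * pd j (pd k (pd k f)) y)"
proof -
  have d: "(\<lambda>y. h y $ i $ j * pd j (pd k (pd k f)) y) differentiable (at y)" for j
    using assms by (intro differentiable_mult h_differentiable slit_differentiable)
  have "pd l (\<lambda>y. \<Sum>j\<in>UNIV. h y $ i $ j * pd j (pd k (pd k f)) y) y =
      (\<Sum>j\<in>UNIV. h y $ i $ j * pd l (pd j (pd k (pd k f))) y
        - (h y ** Third l y ** h y) $ i $ j * pd j (pd k (pd k f)) y)"
    using assms by (simp add: pd_sum d pd_mult h_differentiable slit_differentiable pd_h)
  then show ?thesis
    unfolding flux0_def[abs_def]
    using assms pd_compose_real[OF DERIV_bump slit_differentiable(1)[OF assms], of l]
    by (simp add: pd_mult bump_f_differentiable differentiable_sum d)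
qed

lemma continuous_on_pd_flux0: "continuous_on (- {0}) (pd l (flux0 k i))"
proof -
  have f: "continuous_on (- {0}) (\<lambda>y. bump (f y))" "continuous_on (- {0}) (\<lambda>y. bump' (f y))"
    using smooth_on_imp_continuous_on[OF smooth]
    by (auto intro!: continuous_on_compose2[OF continuous_on_bump', of _ f]
        continuous_on_compose2[of UNIV bump _ f] DERIV_continuous_on DERIV_bump)
  have c: "continuous_on (- {0}) (pd k f)" for k
    by (intro smooth_on_imp_continuous_on smooth_on_pd smooth)
  have c': "continuous_on (- {0}) (pd k (pd i (pd j f)))"
     "continuous_on (- {0}) (pd l (pd k (pd i (pd j f))))" for i j k l
    by (intro smooth_on_imp_continuous_on smooth_on_pd smooth)+
  have "continuous_on (- {0}) (\<lambda>y. bump (f y) * (\<Sum>j\<in>UNIV. h y $ i $ j * pd l (pd j (pd k (pd k f))) y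
        - (h y ** Third l y ** h y) $ i $ j * pd j (pd k (pd k f)) y)
      + bump' (f y) * pd l f y * (\<Sum>j\<in>UNIV. h y $ i $ j * pd j (pd k (pd k f)) y))"
    unfolding matrix_matrix_mult_def vec_lambda_beta
    by (intro continuous_intros continuous_on_h f c c')
  then show ?thesis by (rule continuous_on_eq) (simp add: pd_flux0)
qed

lemma flux_eq_flux0: "y \<noteq> 0 \<Longrightarrow> pd l (flux k i) y = pd l (flux0 k i) y"
  by (rule pd_cong[OF open_slit]) (auto simp: flux_def)

text \<open>Near the origin the quadratic upper bound gives f <= 1, where the cut-off is
  zero.\<close>

lemma flux_near_0:
  obtains r where "0 < r" "\<And>y. y \<in> ball 0 r \<Longrightarrow> flux k i y = 0"
proof -
  obtain M where M: "0 < M" "\<And>y. y \<noteq> 0 \<Longrightarrow> f y \<le> M * (norm y)\<^sup>2" using f_bounds by metis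
  have "flux k i y = 0" if "y \<in> ball 0 (1 / sqrt M)" for y
  proof (cases "y = 0")
    case False
    have "norm y \<le> 1 / sqrt M" using that by simp
    then have "(norm y)\<^sup>2 \<le> 1 / M" using M(1) power_mono[of "norm y" "1 / sqrt M" 2]
      by (simp add: power_divide)
    then have "M * (norm y)\<^sup>2 \<le> 1" using M(1) by (simp add: field_simps)
    then have "f y \<le> 1" using M(2)[OF False] by simp
    then show ?thesis by (simp add: flux_def flux0_def bump_eq_0)
  qed (simp add: flux_def)
  then show ?thesis using that[of "1 / sqrt M"] M(1) by simp
qed

text \<open>Far out the quadratic lower bound gives f >= 2, where the cut-off is zero.\<close>

lemma flux_support:
  obtains R where "\<And>k i y. R < norm y \<Longrightarrow> flux k i y = 0"
proof -
  obtain m where m: "0 < m" "\<And>y. y \<noteq> 0 \<Longrightarrow> m * (norm y)\<^sup>2 \<le> f y" using f_bounds by metis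
  have "flux k i y = 0" if "sqrt (2 / m) < norm y" for k i y
  proof (cases "y = 0")
    case False
    have "(sqrt (2 / m))\<^sup>2 \<le> (norm y)\<^sup>2" using that m(1) by (intro power_mono) auto
    then have "2 \<le> m * (norm y)\<^sup>2" using m(1) by (simp add: field_simps)
    then have "2 \<le> f y" using m(2)[OF False] by simp
    then show ?thesis by (simp add: flux_def flux0_def bump_eq_0)
  qed (simp add: flux_def)
  then show ?thesis using that by blast
qed

lemma flux_differentiable: "flux k i differentiable (at y)"
proof (cases "y = 0")
  case True
  obtain r where "0 < r" "\<And>y. y \<in> ball 0 r \<Longrightarrow> flux k i y = 0" using flux_near_0 by metis
  then show ?thesis
    by (intro differentiable_transform_open[of "\<lambda>_. 0" y "ball 0 r" "flux k i"]) (simp_all add: True)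
next
  case False
  show ?thesis
    by (rule differentiable_transform_open[OF flux0_differentiable[OF False] open_slit])
      (use False in \<open>auto simp: flux_def\<close>)
qed

lemma continuous_on_pd_flux: "continuous_on UNIV (pd l (flux k i))"
proof -
  obtain r where r: "0 < r" "\<And>y. y \<in> ball 0 r \<Longrightarrow> flux k i y = 0" using flux_near_0 by metis
  have "continuous_on (- {0}) (pd l (flux k i))"
    using continuous_on_pd_flux0 by (rule continuous_on_eq) (simp add: flux_eq_flux0)
  moreover have "continuous_on (ball 0 r) (pd l (flux k i))"
    by (rule continuous_on_eq[of _ "\<lambda>_. 0"])
      (use r(2) pd_eq_0_of_locally_0[of "ball 0 r"] in auto)
  moreover have "- {0} \<union> ball 0 r = (UNIV :: (real^'n) set)" using r(1) by auto
  ultimately show ?thesis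
    using continuous_on_open_Un[OF open_slit open_ball, of "pd l (flux k i)" 0 r] by simp
qed

text \<open>The assumption is vanishing mean Cartan torsion. By Jacobi's formula it says that the
  logarithm of the Hessian determinant has zero gradient.\<close>

context
  assumes trace: "\<And>y k. y \<noteq> 0 \<Longrightarrow> (\<Sum>i\<in>UNIV. \<Sum>j\<in>UNIV. h y $ i $ j * pd k (pd i (pd j f)) y) = 0"
begin

text \<open>The product rule gives three contributions: the derivative of the cut-off
  (\<open>T1\<close>) and that of \<open>h\<close> (\<open>T2\<close>) cancel, and the second
  derivatives (\<open>T3\<close>) give the trace.\<close>

lemma divergence_flux:
  assumes "y \<noteq> 0"
  shows "(\<Sum>i\<in>UNIV. pd i (flux k i) y) =
    bump (f y) * (\<Sum>i\<in>UNIV. \<Sum>j\<in>UNIV. (h y ** Third k y ** h y) $ i $ j * Third k y $ i $ j)"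
proof -
  define u where "u = (\<chi> j. pd j (pd k (pd k f)) y)"
  have hsym: "transpose (h y) = h y" using h_pos[OF assms] by (simp add: sym_pos_def_def)
  have T1: "(\<Sum>i\<in>UNIV. pd i f y * (\<Sum>j\<in>UNIV. h y $ i $ j * u $ j)) = 0"
  proof -
    have "(\<Sum>i\<in>UNIV. pd i f y * (\<Sum>j\<in>UNIV. h y $ i $ j * u $ j)) = (\<chi> i. pd i f y) \<bullet> (h y *v u)"
      by (simp add: inner_vec_def matrix_vector_mult_def)
    also have "\<dots> = (h y *v (Hess y *v y)) \<bullet> u"
      using dot_lmul_matrix[of "Hess y *v y" "h y" u] transpose_matrix_vector[of "h y" "Hess y *v y"]
      by (simp only: gradient_eq[OF assms] hsym)
    also have "\<dots> = y \<bullet> u" using inv[OF assms] by (simp add: matrix_vector_mul_assoc)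
    also have "\<dots> = 0"
      using euler_homogeneous[of "pd k (pd k f)" y 0] pd2_hom assms slit_differentiable
      by (simp add: inner_vec_def u_def)
    finally show ?thesis .
  qed
  \<comment> \<open>Symmetry of the third derivatives exchanges the divergence index with a
    summation index; the inner double sum is then the one in \<open>trace\<close>.\<close>
  have T2: "(\<Sum>i\<in>UNIV. (h y ** Third i y ** h y) $ i $ j) = 0" for j
  proof -
    have cyc: "pd i (pd a (pd b f)) y = pd b (pd i (pd a f)) y" for a b i
      using pd3_sym[OF assms] by metis
    have "(\<Sum>i\<in>UNIV. (h y ** Third i y ** h y) $ i $ j) =
        (\<Sum>i\<in>UNIV. \<Sum>b\<in>UNIV. \<Sum>a\<in>UNIV. h y $ b $ j * (h y $ i $ a * pd i (pd a (pd b f)) y))"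
      by (simp add: matrix_matrix_mult_def sum_distrib_left sum_distrib_right mult_ac)
    also have "\<dots> =
        (\<Sum>i\<in>UNIV. \<Sum>b\<in>UNIV. \<Sum>a\<in>UNIV. h y $ b $ j * (h y $ i $ a * pd b (pd i (pd a f)) y))"
      by (intro sum.cong refl arg_cong2[where f="(*)"] cyc)
    also have "\<dots> = (\<Sum>b\<in>UNIV. \<Sum>i\<in>UNIV. \<Sum>a\<in>UNIV. h y $ b $ j * (h y $ i $ a * pd b (pd i (pd a f)) y))"
      by (rule sum.swap)
    also have "\<dots> = (\<Sum>b\<in>UNIV. h y $ b $ j * (\<Sum>i\<in>UNIV. \<Sum>a\<in>UNIV. h y $ i $ a * pd b (pd i (pd a f)) y))"
      by (simp add: sum_distrib_left)
    finally show ?thesis by (simp add: trace[OF assms])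
  qed
  \<comment> \<open>Differentiating \<open>trace\<close> along \<open>k\<close> gives two terms, one
    with fourth derivatives and one with the derivative of \<open>h\<close>, whose sum is
    zero.\<close>
  have T3: "(\<Sum>i\<in>UNIV. \<Sum>j\<in>UNIV. h y $ i $ j * pd i (pd j (pd k (pd k f))) y) =
      (\<Sum>i\<in>UNIV. \<Sum>j\<in>UNIV. (h y ** Third k y ** h y) $ i $ j * Third k y $ i $ j)"
  proof -
    have d: "(\<lambda>y. h y $ i $ j * pd k (pd i (pd j f)) y) differentiable (at y)" for i j
      using assms by (intro differentiable_mult h_differentiable slit_differentiable)
    have "0 = pd k (\<lambda>y. \<Sum>i\<in>UNIV. \<Sum>j\<in>UNIV. h y $ i $ j * pd k (pd i (pd j f)) y) y"
      using pd_eq_0_of_locally_0[OF open_slit, of y] assms trace by simp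
    also have "\<dots> = (\<Sum>i\<in>UNIV. \<Sum>j\<in>UNIV. h y $ i $ j * pd k (pd k (pd i (pd j f))) y
        - (h y ** Third k y ** h y) $ i $ j * pd k (pd i (pd j f)) y)"
      using assms by (simp add: pd_sum d differentiable_sum pd_mult h_differentiable slit_differentiable pd_h)
    finally have "(\<Sum>i\<in>UNIV. \<Sum>j\<in>UNIV. h y $ i $ j * pd k (pd k (pd i (pd j f))) y) =
        (\<Sum>i\<in>UNIV. \<Sum>j\<in>UNIV. (h y ** Third k y ** h y) $ i $ j * Third k y $ i $ j)"
      by (simp add: sum_subtractf)
    moreover have "(\<Sum>i\<in>UNIV. \<Sum>j\<in>UNIV. h y $ i $ j * pd i (pd j (pd k (pd k f))) y) =
        (\<Sum>i\<in>UNIV. \<Sum>j\<in>UNIV. h y $ i $ j * pd k (pd k (pd i (pd j f))) y)"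
      by (intro sum.cong refl arg_cong2[where f="(*)"] pd4_sym assms)
    ultimately show ?thesis by (rule trans[rotated])
  qed
  have "(\<Sum>i\<in>UNIV. pd i (flux k i) y) =
      bump (f y) * ((\<Sum>i\<in>UNIV. \<Sum>j\<in>UNIV. h y $ i $ j * pd i (pd j (pd k (pd k f))) y)
        - (\<Sum>i\<in>UNIV. \<Sum>j\<in>UNIV. (h y ** Third i y ** h y) $ i $ j * u $ j))
      + bump' (f y) * (\<Sum>i\<in>UNIV. pd i f y * (\<Sum>j\<in>UNIV. h y $ i $ j * u $ j))"
    using assms by (simp add: flux_eq_flux0 pd_flux0 sum.distrib sum_subtractf sum_distrib_left u_def mult.assoc right_diff_distrib)
  also have "(\<Sum>i\<in>UNIV. \<Sum>j\<in>UNIV. (h y ** Third i y ** h y) $ i $ j * u $ j) =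
      (\<Sum>j\<in>UNIV. (\<Sum>i\<in>UNIV. (h y ** Third i y ** h y) $ i $ j) * u $ j)"
    by (subst sum.swap) (simp add: sum_distrib_right)
  finally show ?thesis by (simp only: T1 T2 T3) simp
qed

lemma Third_sym: "y \<noteq> 0 \<Longrightarrow> transpose (Third k y) = Third k y"
  by (simp add: transpose_def vec_eq_iff pd3_sym(2)[of y k])

text \<open>The divergence is nonnegative with compact support, hence zero; wherever the cut-off is
  positive, the trace of the square vanishes and with it the matrix \<open>Third k\<close>.\<close>

theorem deicke:
  assumes "y \<noteq> 0"
  shows "pd k (pd i (pd j f)) y = 0"
proof -
  have nonneg: "0 \<le> (\<Sum>i\<in>UNIV. pd i (flux k i) y)" for y
  proof (cases "y = 0")
    case True
    have "pd i (flux k i) y = 0" for i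
    proof -
      obtain r where "0 < r" "\<And>y. y \<in> ball 0 r \<Longrightarrow> flux k i y = 0" using flux_near_0 by metis
      then show ?thesis using True by (intro pd_eq_0_of_locally_0[of "ball 0 r"]) auto
    qed
    then show ?thesis by simp
  next
    case False
    show ?thesis
      unfolding divergence_flux[OF False]
      by (intro mult_nonneg_nonneg bump_nonneg trace_square_nonneg(1) h_pos[OF False] Third_sym[OF False])
  qed
  obtain R where "\<And>k i y. R < norm y \<Longrightarrow> flux k i y = 0" using flux_support by metis
  then have div0: "(\<Sum>i\<in>UNIV. pd i (flux k i) y) = 0" for y
    by (intro nonneg_divergence_eq_0[where V = "flux k"] flux_differentiable continuous_on_pd_flux nonneg)
  \<comment> \<open>This scales \<open>y\<close> to the level f = 3/2, where the cut-off is
    positive. Homogeneity carries the vanishing back to \<open>y\<close>.\<close>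
  define t where "t = sqrt (3 / 2 / f y)"
  have t: "0 < t" "t *\<^sub>R y \<noteq> 0" using f_pos[OF assms] assms by (auto simp: t_def)
  have "f (t *\<^sub>R y) = 3 / 2" using hom[OF t(1) assms] f_pos[OF assms] by (simp add: t_def)
  then have "bump (f (t *\<^sub>R y)) \<noteq> 0" by (simp add: bump_def)
  then have "(\<Sum>i\<in>UNIV. \<Sum>j\<in>UNIV. (h (t *\<^sub>R y) ** Third k (t *\<^sub>R y) ** h (t *\<^sub>R y)) $ i $ j * Third k (t *\<^sub>R y) $ i $ j) = 0"
    using div0[of "t *\<^sub>R y"] divergence_flux[OF t(2), of k] by (simp only: mult_eq_0_iff) simp
  then have "Third k (t *\<^sub>R y) = 0"
    using trace_square_nonneg(2)[OF h_pos Third_sym _ inv] t(2) by blast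
  then have "pd k (pd i (pd j f)) (t *\<^sub>R y) = 0" by (simp add: vec_eq_iff)
  then show ?thesis using pd3_hom[OF t(1) assms, of k i j] by simp
qed

end
end

subsection \<open>AR-Finsler metrics\<close>

lemma fibre_partial_eq_pd: "fibre_partial i f x = pd i (f x)"
  by (simp add: fibre_partial_def pd_def fun_eq_iff)

lemma tvec_scale:
  assumes "smooth_manifold X A" "c \<in> A" "x \<in> chart_image c"
  shows "tvec A c x (t *\<^sub>R y) = scale_tv t (tvec A c x y)"
proof -
  have p: "chart_inv c x \<in> chart_dom c" "chart_map c (chart_inv c x) = x"
    using chart_map_inv[OF assms(1,3)] by auto
  have "frechet_derivative (transition c d) (at x) (t *\<^sub>R y) = t *\<^sub>R frechet_derivative (transition c d) (at x) y"
    if "d \<in> A" "chart_inv c x \<in> chart_dom d" for d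
  proof -
    have "bounded_linear (frechet_derivative (transition c d) (at x))"
      using transition_has_derivative[OF assms(1,2) that(1) p(1) that(2)] p(2)
      by (simp add: has_derivative_bounded_linear)
    then show ?thesis by (rule linear_cmul[OF bounded_linear.linear])
  qed
  then show ?thesis by (auto simp: tvec_def scale_tv_def fun_eq_iff)
qed

lemma smooth_on_slice:
  "open U \<Longrightarrow> open V \<Longrightarrow> x \<in> U \<Longrightarrow> smooth_on (U \<times> V) f \<Longrightarrow> smooth_on V (\<lambda>y. f (x, y))"
  unfolding smooth_on_def using Ck_on_slice by blast

lemma smooth_on_mult:
  fixes f g :: "'a::euclidean_space \<Rightarrow> real"
  shows "open S \<Longrightarrow> smooth_on S f \<Longrightarrow> smooth_on S g \<Longrightarrow> smooth_on S (\<lambda>x. f x * g x)"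
  unfolding smooth_on_def using Ck_on_mult by blast

lemma smooth_on_slit_fibre:
  assumes "smooth_manifold X A" "smooth_on_slit_TM A f" "c \<in> A" "x \<in> chart_image c"
  shows "smooth_on (- {0}) (in_coords A f c x)"
proof -
  have "open (chart_image c)" using assms(1,3) by (auto simp: smooth_manifold_def is_chart_def)
  moreover have "open (- {0 :: real^'b})" by (rule open_Compl) simp
  moreover have "smooth_on (chart_image c \<times> (- {0})) (\<lambda>(x, y). in_coords A f c x y)"
    using assms(2,3) by (simp add: smooth_on_slit_TM_def)
  ultimately have "smooth_on (- {0}) (\<lambda>y. (\<lambda>(x, y). in_coords A f c x y) (x, y))"
    using assms(4) by (intro smooth_on_slice)
  then show ?thesis by simp
qed

lemma sym_pos_def_scaleR: "sym_pos_def B \<Longrightarrow> 0 < t \<Longrightarrow> sym_pos_def (t *\<^sub>R B)"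
  unfolding sym_pos_def_def
  by (simp add: scaleR_matrix_vector_assoc[symmetric] transpose_scalar)

text \<open>By symmetry of \<open>B\<close> the double sum is the trace of the identity. This is the
  origin of the factor 1/n in the condition.\<close>

lemma sum_matrix_inv_mult:
  fixes B :: "real^'n::finite^'n"
  assumes "sym_pos_def B"
  shows "(\<Sum>j\<in>UNIV. \<Sum>k\<in>UNIV. matrix_inv B $ j $ k * B $ j $ k) = real CARD('n)"
proof -
  have "transpose B = B" using assms by (simp add: sym_pos_def_def)
  then have "B $ j $ k = B $ k $ j" for j k by (simp add: transpose_def vec_eq_iff)
  then have "(\<Sum>k\<in>UNIV. matrix_inv B $ j $ k * B $ j $ k) = (matrix_inv B ** B) $ j $ j" for j
    by (simp add: matrix_matrix_mult_def)
  then show ?thesis by (simp add: sym_pos_def_inverse_exists[OF assms] mat_def)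
qed

text \<open>By the product rule, contracting the derivative of \<open>e * a\<close> with the inverse
  of \<open>a\<close> gives \<open>e\<close> times the contracted derivative of \<open>a\<close>
  plus n times the derivative of \<open>e\<close>. Dividing by n and by \<open>e\<close> leaves the
  logarithmic derivative.\<close>

lemma mean_cartan_condition:
  fixes e :: "real^'n::finite \<Rightarrow> real" and a :: "real^'n \<Rightarrow> real^'n^'n"
  assumes a: "sym_pos_def (a y)" and e: "0 < e y" "e differentiable (at y)"
    and diff: "\<And>j k. (\<lambda>y. a y $ j $ k) differentiable (at y)"
  shows "(pd i (\<lambda>y. ln (e y)) y = - (1 / real CARD('n)) *
       (\<Sum>j\<in>UNIV. \<Sum>k\<in>UNIV. matrix_inv (a y) $ j $ k * pd i (\<lambda>y. a y $ j $ k) y)) \<longleftrightarrow>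
     (\<Sum>j\<in>UNIV. \<Sum>k\<in>UNIV. matrix_inv (a y) $ j $ k * pd i (\<lambda>y. e y * a y $ j $ k) y) = 0"
proof -
  let ?s = "\<Sum>j\<in>UNIV. \<Sum>k\<in>UNIV. matrix_inv (a y) $ j $ k * pd i (\<lambda>y. a y $ j $ k) y"
  have "pd i (\<lambda>y. ln (e y)) y = inverse (e y) * pd i e y"
    by (rule pd_compose_real[OF DERIV_ln[OF e(1)] e(2)])
  moreover have "(\<Sum>j\<in>UNIV. \<Sum>k\<in>UNIV. matrix_inv (a y) $ j $ k * pd i (\<lambda>y. e y * a y $ j $ k) y) =
      e y * ?s + pd i e y * real CARD('n)"
    unfolding sum_matrix_inv_mult[OF a, symmetric]
    by (simp add: pd_mult e diff sum_distrib_left sum.distrib algebra_simps)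
  moreover have "inverse E * P = - (1 / n) * s \<longleftrightarrow> E * s + P * n = 0" if "0 < E" "0 < n" for E P n s :: real
    using that by (simp add: field_simps) (simp add: eq_neg_iff_add_eq_0 ac_simps)
  ultimately show ?thesis using e(1) by simp
qed

context
  fixes X :: "'m topology"
    and A :: "('m, 'n::finite) chart set"
    and F \<eta> :: "('m, 'n) tvector \<Rightarrow> real"
    and a :: "('m, 'n) chart \<Rightarrow> real^'n \<Rightarrow> real^'n \<Rightarrow> real^'n^'n"
    and c :: "('m, 'n) chart" and x :: "real^'n"
  assumes mfd: "smooth_manifold X A" and ar: "ar_finsler X A F \<eta> a"
    and c: "c \<in> A" and x: "x \<in> chart_image c"
begin

section \<open>The metric and its decomposition at a fixed base point\<close>

abbreviation "fsq \<equiv> \<lambda>y. (in_coords A F c x y)\<^sup>2"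

lemma finsler: "finsler_metric X A F"
  using ar by (simp add: ar_finsler_def)

lemma fsq_smooth: "smooth_on (- {0}) fsq"
proof -
  have "smooth_on (- {0}) (in_coords A F c x)"
    using finsler by (intro smooth_on_slit_fibre[OF mfd _ c x]) (simp add: finsler_metric_def)
  then show ?thesis
    unfolding power2_eq_square by (intro smooth_on_mult open_Compl) auto
qed

lemma fsq_hom: "t > 0 \<Longrightarrow> fsq (t *\<^sub>R y) = t ^ 2 * fsq y"
  using finsler tvec_in_TM[OF mfd c x, of y]
  by (simp add: in_coords_def tvec_scale[OF mfd c x] finsler_metric_def power_mult_distrib)

lemma fund_tensor_eq: "fund_tensor A F c x y = (1/2) *\<^sub>R (\<chi> i j. pd i (pd j fsq) y)"
  by (simp add: fund_tensor_def fibre_partial_eq_pd vec_eq_iff)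

lemma fund_tensor_pos: "y \<noteq> 0 \<Longrightarrow> sym_pos_def (fund_tensor A F c x y)"
  using finsler c x by (simp add: finsler_metric_def)

lemma hessian_pos:
  assumes "y \<noteq> 0"
  shows "sym_pos_def (\<chi> i j. pd i (pd j fsq) y)"
  using sym_pos_def_scaleR[OF fund_tensor_pos[OF assms], of 2] by (simp add: fund_tensor_eq)

lemma a_pos: "y \<noteq> 0 \<Longrightarrow> sym_pos_def (a c x y)"
  using ar c x by (simp add: ar_finsler_def)

lemma fund_tensor_decomposition: "y \<noteq> 0 \<Longrightarrow> fund_tensor A F c x y = in_coords A \<eta> c x y *\<^sub>R a c x y"
  using ar c x by (simp add: ar_finsler_def)

text \<open>The definition only gives a nonnegative factor; strictness follows because both forms
  are positive at \<open>y\<close>. It makes the logarithm and the division by \<open>\<eta>\<close>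
  meaningful.\<close>

lemma eta_pos:
  assumes "y \<noteq> 0"
  shows "0 < in_coords A \<eta> c x y"
proof -
  have "0 < y \<bullet> (fund_tensor A F c x y *v y)" "0 < y \<bullet> (a c x y *v y)"
    using fund_tensor_pos[OF assms] a_pos[OF assms] assms by (auto simp: sym_pos_def_def)
  then show ?thesis
    by (simp add: fund_tensor_decomposition[OF assms] scaleR_matrix_vector_assoc[symmetric]
        zero_less_mult_iff)
qed

lemma eta_differentiable:
  assumes "y \<noteq> 0"
  shows "in_coords A \<eta> c x differentiable (at y)"
proof -
  have "smooth_on (- {0}) (in_coords A \<eta> c x)"
    using ar by (intro smooth_on_slit_fibre[OF mfd _ c x]) (simp add: ar_finsler_def)
  then show ?thesis using assms by (auto intro: smooth_on_imp_differentiable)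
qed

lemma hessian_eq: "y \<noteq> 0 \<Longrightarrow> pd j (pd k fsq) y = 2 * (in_coords A \<eta> c x y * a c x y $ j $ k)"
  using fund_tensor_decomposition[of y] by (simp add: fund_tensor_eq vec_eq_iff)

lemma hessian_differentiable: "y \<noteq> 0 \<Longrightarrow> pd j (pd k fsq) differentiable (at y)"
  by (rule smooth_on_imp_differentiable[of "- {0}"]) (auto intro: smooth_on_pd fsq_smooth)

text \<open>Each entry is a second derivative of \<open>fsq\<close> divided by
  \<open>2 * \<eta>\<close>, a quotient of differentiable functions with positive
  denominator.\<close>

lemma a_differentiable:
  assumes "y \<noteq> 0"
  shows "(\<lambda>y. a c x y $ j $ k) differentiable (at y)"
proof (rule differentiable_transform_open[of _ _ "- {0}"])
  show "(\<lambda>y. pd j (pd k fsq) y / (2 * in_coords A \<eta> c x y)) differentiable (at y)"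
    using eta_pos[OF assms] assms
    by (intro differentiable_divide differentiable_mult differentiable_const hessian_differentiable
        eta_differentiable) auto
  show "pd j (pd k fsq) z / (2 * in_coords A \<eta> c x z) = a c x z $ j $ k" if "z \<in> - {0}" for z
    using eta_pos[of z] that by (simp add: hessian_eq)
qed (use assms in \<open>auto intro: open_Compl\<close>)

lemma pd3_eq:
  assumes "y \<noteq> 0"
  shows "pd i (pd j (pd k fsq)) y = 2 * pd i (\<lambda>y. in_coords A \<eta> c x y * a c x y $ j $ k) y"
proof -
  have "pd i (pd j (pd k fsq)) y = pd i (\<lambda>y. 2 * (in_coords A \<eta> c x y * a c x y $ j $ k)) y"
    by (rule pd_cong[of "- {0}"]) (use assms hessian_eq in \<open>auto intro: open_Compl\<close>)
  then show ?thesis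
    by (simp add: pd_cmult differentiable_mult eta_differentiable[OF assms] a_differentiable[OF assms])
qed

lemma cartan_torsion_eq:
  assumes "y \<noteq> 0"
  shows "cartan_torsion A F c i j k x y = 1/4 * pd k (pd i (pd j fsq)) y"
proof -
  have "(\<lambda>y. fund_tensor A F c x y $ i $ j) = (\<lambda>y. 1/2 * pd i (pd j fsq) y)"
    by (simp add: fund_tensor_eq)
  then show ?thesis
    using pd_cmult[OF hessian_differentiable[OF assms], of k "1/2" i j]
    by (simp add: cartan_torsion_def fibre_partial_eq_pd)
qed

text \<open>The equivalence holds in each tangent space separately. The left side says that all
  third derivatives of \<open>fsq\<close> vanish, the right side that their contractions with the
  inverse of \<open>a\<close> do; \<open>deicke\<close> leads from the second to the first.\<close>

lemma riemannian_at_iff: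
  "(\<forall>y. y \<noteq> 0 \<longrightarrow> (\<forall>i j k. cartan_torsion A F c i j k x y = 0)) \<longleftrightarrow>
   (\<forall>y. y \<noteq> 0 \<longrightarrow> (\<forall>i. fibre_partial i (\<lambda>x y. ln (in_coords A \<eta> c x y)) x y
            = - (1 / real CARD('n)) *
              (\<Sum>j\<in>UNIV. \<Sum>k\<in>UNIV. matrix_inv (a c x y) $ j $ k
                 * fibre_partial i (\<lambda>x y. a c x y $ j $ k) x y)))" (is "?L \<longleftrightarrow> ?R")
proof -
  have R: "?R \<longleftrightarrow> (\<forall>y. y \<noteq> 0 \<longrightarrow> (\<forall>i.
      (\<Sum>j\<in>UNIV. \<Sum>k\<in>UNIV. matrix_inv (a c x y) $ j $ k * pd i (pd j (pd k fsq)) y) = 0))"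
  proof -
    have "(\<Sum>j\<in>UNIV. \<Sum>k\<in>UNIV. matrix_inv (a c x y) $ j $ k * pd i (pd j (pd k fsq)) y) =
        2 * (\<Sum>j\<in>UNIV. \<Sum>k\<in>UNIV. matrix_inv (a c x y) $ j $ k *
          pd i (\<lambda>y. in_coords A \<eta> c x y * a c x y $ j $ k) y)" if "y \<noteq> 0" for y i
      by (simp add: pd3_eq[OF that] sum_distrib_left mult_ac)
    then show ?thesis
      using mean_cartan_condition[of "a c x" _ "in_coords A \<eta> c x"] a_pos eta_pos
        eta_differentiable a_differentiable
      by (simp add: fibre_partial_eq_pd less_imp_neq[symmetric] cong: imp_cong)
  qed
  have L: "?L \<longleftrightarrow> (\<forall>y. y \<noteq> 0 \<longrightarrow> (\<forall>i j k. pd k (pd i (pd j fsq)) y = 0))"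
    by (simp add: cartan_torsion_eq cong: imp_cong)
  \<comment> \<open>The Hessian of \<open>fsq\<close> is \<open>2 * \<eta>\<close> times
    \<open>a\<close>, so this is its inverse.\<close>
  define h where "h y = (1 / (2 * in_coords A \<eta> c x y)) *\<^sub>R matrix_inv (a c x y)" for y
  have inv: "h y ** (\<chi> i j. pd i (pd j fsq) y) = mat 1" if "y \<noteq> 0" for y
  proof -
    have "(\<chi> i j. pd i (pd j fsq) y) = (2 * in_coords A \<eta> c x y) *\<^sub>R a c x y"
      by (simp add: vec_eq_iff hessian_eq[OF that])
    then show ?thesis
      using eta_pos[OF that] sym_pos_def_inverse_exists[OF a_pos[OF that]]
      by (simp add: h_def scalar_matrix_assoc[symmetric] matrix_scalar_ac)
  qed
  show ?thesis
  proof
    assume ?L then show ?R unfolding L R by simp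
  next
    assume ?R
    \<comment> \<open>The inverses of \<open>a\<close> and of the Hessian differ by a scalar at each
      point, which does not affect the vanishing of the contraction.\<close>
    then have "(\<Sum>i\<in>UNIV. \<Sum>j\<in>UNIV. h y $ i $ j * pd k (pd i (pd j fsq)) y) = 0" if "y \<noteq> 0" for y k
      using that unfolding R
      by (simp add: h_def mult.assoc sum_distrib_left[symmetric] sum_divide_distrib[symmetric])
    then show ?L unfolding L
      using deicke[OF fsq_smooth fsq_hom hessian_pos inv] by blast
  qed
qed

end

theorem theorem3p10:
  fixes X :: "'m topology"
    and A :: "('m, 'n::finite) chart set"
    and F \<eta> :: "('m, 'n) tvector \<Rightarrow> real"
    and a :: "('m, 'n) chart \<Rightarrow> real^'n \<Rightarrow> real^'n \<Rightarrow> real^'n^'n"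
  assumes "smooth_manifold X A"
    and "ar_finsler X A F \<eta> a"
  shows "riemannian A F \<longleftrightarrow>
    (\<forall>c\<in>A. \<forall>x\<in>chart_image c. \<forall>y. y \<noteq> 0 \<longrightarrow>
       (\<forall>i. fibre_partial i (\<lambda>x y. ln (in_coords A \<eta> c x y)) x y
            = - (1 / real CARD('n)) *
              (\<Sum>j\<in>UNIV. \<Sum>k\<in>UNIV. matrix_inv (a c x y) $ j $ k
                 * fibre_partial i (\<lambda>x y. a c x y $ j $ k) x y)))"
  unfolding riemannian_def
  by (intro ball_cong refl riemannian_at_iff[OF assms])

end
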